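(* Consider a two-dimensional system $\dot x=f(x)$ with $f:U\to\mathbb{R}^2$ of class $C^2$ on an open set $U\subset\mathbb{R}^2$, and assume that it has an isolated equilibrium $x^*\in U$ which is hyperbolic. Let $\lambda_1>0>\lambda_2$ denote the eigenvalues of $D_xf(x^* )$ with corresponding normalized eigenvectors $e_1,e_2$. Then for all $\varepsilon\in(0,\min\{\lambda_1,-\lambda_2\})$ there exists $T(\varepsilon)>0$ such that for all $T\ge T(\varepsilon)$ there exists a $\delta(T)>0$ such that the weighted FTME field $H(x)=h^{\alpha(x,T,f(x))}(x)$ satisfies the following properties: (i) (Bound for weighted FTME field) $H(x)\in[0,\lambda_1-\lambda_2+\varepsilon)$ for $x\in B(x^*,\delta(T))$. (ii) (Unstable cone contains unstable manifold and has minimal FTME values) The unstable cone at $x^*$ $$C^u=\Big\{x_0\in\mathbb{R}^2:\ \sin\Big|\angle\Big(\tfrac{x_0-x^*}{\|x_0-x^*\|},e_2\Big)\Big|\ \ge\ 2e^{-\frac\varepsilon4T}\Big\}$$ contains a piece of the unstable manifold $W^u=\{x_0\in U:\lim_{t\to-\infty}\varphi(t,x_0)=x^*\}$ at $x^*$, namely $$W^u\cap B(x^*,\delta(T))\subset C^u,$$ and $H(x)\in[0,\varepsilon)$ for all $x\in C^u\cap B(x^*,\delta(T))$. (iii) (Stable cone contains stable manifold and has maximal FTME values) The stable cone at $x^*$ $$C^s=\Big\{x_0\in\mathbb{R}^2:\ \sin\Big|\angle\Big(\tfrac{x_0-x^*}{\|x_0-x^*\|},e_2\Big)\Big|\ \le\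 \tfrac\varepsilon4e^{(\lambda_2-\lambda_1)T}\Big\}$$ contains a piece of the stable manifold $W^s=\{x_0\in U:\lim_{t\to\infty}\varphi(t,x_0)=x^*\}$ at $x^*$, namely $$W^s\cap B(x^*,\delta(T))\subset C^s,$$ and $H(x)>\lambda_1-\varepsilon$ for all $x\in C^s\cap B(x^*,\delta(T))$. Moreover, along the stable manifold $H(x)\in(\lambda_1-\lambda_2-\varepsilon,\lambda_1-\lambda_2+\varepsilon)$ for all $x\in W^s\cap B(x^*,\delta(T))$.
   Context: $\|\cdot\|$ is the Euclidean norm, $\mu$ is Lebesgue measure on $\mathbb{R}^2$, $B(x,r):=\{y\in\mathbb{R}^2:\|y-x\|\le r\}$, and $\angle(v,w)$ is the angle between nonzero vectors. An equilibrium is hyperbolic if no eigenvalue of $D_xf(x^* )$ lies on the imaginary axis. $\varphi(t,x_0)$ denotes the solution at time $t$ of $\dot x=f(x)$, $x(0)=x_0$. For $T>0$ let $X(0)\subseteq U$ be the set of initial values whose solution exists on $[0,T]$. For $x\in X(0)$, $\alpha\in\mathbb{R}$, $r>0$ let $$B^{\alpha}(x,r):=\{y\in X(0):\ \|y-x\|\le r,\ \|\varphi(T,y)-\varphi(T,x)\|\le r e^{\alpha T}\}.$$ The finite-time metric entropy (FTME) over the two-point time set $\{0,T\}$ with weight $\alpha$ at $x$ (and initial time $0$) is $$h^{\alpha}(x):=\limsup_{r\to0}-\frac1T\log\frac{\mu(B^{\alpha}(x,r))}{\mu(B(x,r))}.$$ For $x\in X(0)$ with $f(x)\ne0$, the directional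 stretching rate in the direction of the vector field is $$\alpha(x,T,f(x))=\frac1T\log\frac{\|\Phi_x(T)f(x)\|}{\|f(x)\|}=\frac1T\log\frac{\|f(\varphi(T,x))\|}{\|f(x)\|},\qquad \Phi_x(T):=D_x\varphi(T,x),$$ and the weighted FTME field is $x\mapsto H(x):=h^{\alpha(x,T,f(x))}(x)$ (for each fixed $T$). Since $H$ and the angles defining the cones are undefined at $x^*$ itself, all assertions about points are understood for points different from $x^*$.
   Formalization: W^u and W^s are taken as local manifolds (orbits staying in a neighbourhood V of x*, chosen before ε), since with the global manifolds in U the claims about them fail when x* has a homoclinic orbit, e.g. f(x,y)=(y,x−x²) at 0. *)

theory Defs
  imports "HOL-Analysis.Analysis"
begin

text \<open>Functions on \<open>U\<close> are total functions of which only the values on \<open>U\<close> are used.\<close>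

definition C2_on :: "('a::real_normed_vector \<Rightarrow> 'b::real_normed_vector) \<Rightarrow> 'a set \<Rightarrow> bool" where
  "C2_on f U \<longleftrightarrow>
     (\<exists>(D1 :: 'a \<Rightarrow> 'a \<Rightarrow>\<^sub>L 'b) (D2 :: 'a \<Rightarrow> 'a \<Rightarrow>\<^sub>L ('a \<Rightarrow>\<^sub>L 'b)).
        (\<forall>x\<in>U. (f has_derivative blinfun_apply (D1 x)) (at x)) \<and>
        (\<forall>x\<in>U. (D1 has_derivative blinfun_apply (D2 x)) (at x)) \<and>
        continuous_on U D2)"

definition eigenpair :: "'a::comm_ring_1^'n^'n \<Rightarrow> 'a \<Rightarrow> 'a^'n \<Rightarrow> bool" where
  "eigenpair A l v \<longleftrightarrow> v \<noteq> 0 \<and> A *v v = l *s v"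

definition isolated_equilibrium :: "(real^2 \<Rightarrow> real^2) \<Rightarrow> (real^2) set \<Rightarrow> real^2 \<Rightarrow> bool" where
  "isolated_equilibrium f U xs \<longleftrightarrow> xs isolated_in {x\<in>U. f x = 0}"

definition hyperbolic_at :: "(real^2 \<Rightarrow> real^2) \<Rightarrow> real^2 \<Rightarrow> bool" where
  "hyperbolic_at f xs \<longleftrightarrow>
     (\<forall>(\<mu>::complex) v. eigenpair (map_matrix of_real (jacobian f (at xs))) \<mu> v \<longrightarrow> Re \<mu> \<noteq> 0)"

definition solution_on ::
  "(real^2 \<Rightarrow> real^2) \<Rightarrow> (real^2) set \<Rightarrow> real^2 \<Rightarrow> real set \<Rightarrow> (real \<Rightarrow> real^2) \<Rightarrow> bool" where
  "solution_on f U x0 I x \<longleftrightarrow>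
     x 0 = x0 \<and> (\<forall>t\<in>I. x t \<in> U \<and> (x has_vector_derivative f (x t)) (at t within I))"

text \<open>Only meaningful when a solution from \<open>x0\<close> in \<open>U\<close> exists between times \<open>0\<close> and \<open>t\<close>
  (\<open>t\<close> may be negative) and is unique, as is the case for \<open>f\<close> of class \<open>C\<^sup>2\<close> on an open set.\<close>

definition flow :: "(real^2 \<Rightarrow> real^2) \<Rightarrow> (real^2) set \<Rightarrow> real \<Rightarrow> real^2 \<Rightarrow> real^2" where
  "flow f U t x0 = (THE y. \<exists>x. solution_on f U x0 (closed_segment 0 t) x \<and> x t = y)"

definition X0 :: "(real^2 \<Rightarrow> real^2) \<Rightarrow> (real^2) set \<Rightarrow> real \<Rightarrow> (real^2) set" where
  "X0 f U T = {x0\<in>U. \<exists>x. solution_on f U x0 {0..T} x}"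

definition ftme_ball ::
  "(real^2 \<Rightarrow> real^2) \<Rightarrow> (real^2) set \<Rightarrow> real \<Rightarrow> real \<Rightarrow> real^2 \<Rightarrow> real \<Rightarrow> (real^2) set" where
  "ftme_ball f U T \<alpha> x r =
     {y \<in> X0 f U T. norm (y - x) \<le> r \<and> norm (flow f U T y - flow f U T x) \<le> r * exp (\<alpha> * T)}"

text \<open>For \<open>x \<in> X0 f U T\<close>, \<open>T > 0\<close>, the measure of the Bowen-type ball is positive by continuity
  of the time-\<open>T\<close> map, so the convention \<open>ln 0 = 0\<close> plays no role.\<close>

definition ftme :: "(real^2 \<Rightarrow> real^2) \<Rightarrow> (real^2) set \<Rightarrow> real \<Rightarrow> real \<Rightarrow> real^2 \<Rightarrow> ereal" where
  "ftme f U T \<alpha> x =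
     Limsup (at_right 0) (\<lambda>r. ereal (- (1 / T) *
       ln (measure lebesgue (ftme_ball f U T \<alpha> x r) / measure lebesgue (cball x r))))"

definition stretching_rate ::
  "(real^2 \<Rightarrow> real^2) \<Rightarrow> (real^2) set \<Rightarrow> real^2 \<Rightarrow> real \<Rightarrow> real^2 \<Rightarrow> real" where
  "stretching_rate f U x T v =
     1 / T * ln (norm (frechet_derivative (flow f U T) (at x) v) / norm v)"

definition weighted_ftme :: "(real^2 \<Rightarrow> real^2) \<Rightarrow> (real^2) set \<Rightarrow> real \<Rightarrow> real^2 \<Rightarrow> ereal" where
  "weighted_ftme f U T x = ftme f U T (stretching_rate f U x T (f x)) x"

definition weighted_ftme_domain ::
  "(real^2 \<Rightarrow> real^2) \<Rightarrow> (real^2) set \<Rightarrow> real \<Rightarrow> (real^2) set" where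
  "weighted_ftme_domain f U T = {x \<in> X0 f U T. f x \<noteq> 0}"

definition vec_angle :: "real^2 \<Rightarrow> real^2 \<Rightarrow> real" where
  "vec_angle v w = arccos (v \<bullet> w / (norm v * norm w))"

definition unstable_cone :: "real \<Rightarrow> real \<Rightarrow> real^2 \<Rightarrow> real^2 \<Rightarrow> (real^2) set" where
  "unstable_cone \<epsilon> T xs e2 =
     {x0. x0 \<noteq> xs \<and>
        sin \<bar>vec_angle ((x0 - xs) /\<^sub>R norm (x0 - xs)) e2\<bar> \<ge> 2 * exp (- (\<epsilon> / 4) * T)}"

definition stable_cone ::
  "real \<Rightarrow> real \<Rightarrow> real \<Rightarrow> real \<Rightarrow> real^2 \<Rightarrow> real^2 \<Rightarrow> (real^2) set" where
  "stable_cone l1 l2 \<epsilon> T xs e2 =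
     {x0. x0 \<noteq> xs \<and>
        sin \<bar>vec_angle ((x0 - xs) /\<^sub>R norm (x0 - xs)) e2\<bar> \<le> \<epsilon> / 4 * exp ((l2 - l1) * T)}"

text \<open>
  The invariant manifolds carry the domain as a parameter. For an open neighbourhood \<open>V \<subseteq> U\<close> of the
  equilibrium, \<open>unstable_manifold f V xs\<close> is the local unstable manifold: orbits must stay in \<open>V\<close>
  for all \<open>t \<le> 0\<close>, and every backward orbit converging to \<open>xs\<close> in \<open>U\<close> eventually lies in it.
  The local version is needed for inclusions such as
  \<open>unstable_manifold f V xs \<inter> cball xs \<delta> - {xs} \<subseteq> unstable_cone \<epsilon> T xs e2\<close>: with \<open>V = U\<close> they
  fail if there is a homoclinic orbit, e.g. for \<open>f (x, y) = (y, x - x\<^sup>2)\<close> on the whole plane at the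
  origin, where the global unstable manifold returns to the origin tangentially to \<open>e2\<close>.
\<close>

definition unstable_manifold :: "(real^2 \<Rightarrow> real^2) \<Rightarrow> (real^2) set \<Rightarrow> real^2 \<Rightarrow> (real^2) set" where
  "unstable_manifold f V xs =
     {x0\<in>V. (\<exists>x. solution_on f V x0 {..0} x) \<and> ((\<lambda>t. flow f V t x0) \<longlongrightarrow> xs) at_bot}"

definition stable_manifold :: "(real^2 \<Rightarrow> real^2) \<Rightarrow> (real^2) set \<Rightarrow> real^2 \<Rightarrow> (real^2) set" where
  "stable_manifold f V xs =
     {x0\<in>V. (\<exists>x. solution_on f V x0 {0..} x) \<and> ((\<lambda>t. flow f V t x0) \<longlongrightarrow> xs) at_top}"

end

theory Submission
  imports Defs
begin

text \<open>
  For fixed \<open>T\<close> and \<open>x\<close> close to the equilibrium, the time-\<open>T\<close> map is differentiable with derivative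
  arbitrarily close to \<open>exp (T A)\<close>, \<open>A\<close> the linearization. In eigencoordinates
  \<open>y - x = u e1 + v e2\<close> the dynamical ball of radius \<open>r\<close> is therefore comparable with the parallelogram
  \<open>\<bar>u\<bar> \<le> a exp (- l1 T) r\<close>, \<open>\<bar>v\<bar> \<le> r\<close>, where \<open>a\<close> is the stretching factor along \<open>f x\<close>, so up to
  \<open>O(1 / T)\<close> the weighted FTME is \<open>l1 - ln a / T\<close>. As \<open>f x\<close> is close to \<open>A (x - xs)\<close>, the factor \<open>a\<close> is at
  least of order \<open>exp (l2 T)\<close>; it is nearly \<open>exp (l1 T)\<close> on the unstable cone and of order \<open>exp (l2 T)\<close>
  on the stable cone. The manifolds are taken in a small ball \<open>V\<close>: an orbit confined to \<open>V\<close> in forward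
  (backward) time cannot enter the expanding cone \<open>\<bar>u\<bar> > k \<bar>v\<bar>\<close> (\<open>\<bar>v\<bar> > \<bar>u\<bar>\<close>), where the dominating
  coordinate would grow exponentially.
\<close>

section \<open>Gronwall and Picard-Lindelof\<close>

text \<open>The order of quantifiers shapes the proof: \<open>V\<close> is fixed first, then
  \<open>\<epsilon>\<close>, then \<open>T\<close>, and \<open>\<delta>\<close> last. The weakest
  stretching is of order \<open>exp (l2 * T)\<close>, so the linearization error
  \<open>\<eta>\<close> has to be a small multiple of that; this is affordable because
  \<open>\<delta>\<close> may depend on \<open>T\<close>. For the stable manifold the same order is
  an obstacle: the stable cone narrows like \<open>exp ((l2 - l1) * T)\<close>, while confinement to
  the fixed \<open>V\<close> gives only a cone of opening 1. Two scales resolve this. Inside the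
  wide cone the contracting coordinate cannot grow, so an orbit starting within
  \<open>\<delta>\<close> of the equilibrium stays within \<open>2 / s0 * \<delta>\<close>;
  confinement to this smaller ball then gives the narrow cone. The unstable cone omits only a narrow
  sector around \<open>e2\<close>, so there the wide cone is enough.\<close>

lemma gronwall_real:
  fixes N N' :: "real \<Rightarrow> real"
  assumes der: "\<And>s. s \<in> {0..T} \<Longrightarrow> (N has_real_derivative N' s) (at s within {0..T})"
    and le: "\<And>s. s \<in> {0..T} \<Longrightarrow> N' s \<le> K * N s + c"
    and "0 \<le> K" "0 \<le> c" and t: "t \<in> {0..T}"
  shows "N t \<le> (N 0 + c * t) * exp (K * t)"
proof -
  \<comment> \<open>The derivative of \<open>g\<close> is at most
    \<open>c * (exp (- K * s) - 1)\<close>, hence nonpositive, so \<open>g\<close> does not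
    increase. \<open>N\<close> may be negative: it will also be \<open>- W\<close> for a growing
    quantity \<open>W\<close>.\<close>
  define g where "g s = N s * exp (- K * s) - c * s" for s
  have sub: "{0..t} \<subseteq> {0..T}" using t by auto
  have "(g has_derivative (\<lambda>h. h * ((N' s - K * N s) * exp (- K * s) - c))) (at s within {0..t})"
    if "0 \<le> s" "s \<le> t" for s
  proof -
    have "(N has_real_derivative N' s) (at s within {0..t})"
      using der[of s] sub that t by (auto intro: DERIV_subset)
    then show ?thesis
      unfolding g_def has_field_derivative_def[symmetric]
      by (auto intro!: derivative_eq_intros simp: has_field_derivative_def algebra_simps fun_eq_iff)
  qed
  from mvt_very_simple[OF _ this] t obtain s where s: "s \<in> {0..t}"
    and eq: "g t - g 0 = (t - 0) * ((N' s - K * N s) * exp (- K * s) - c)" by auto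
  have "(N' s - K * N s) * exp (- K * s) \<le> c * exp (- K * s)"
    using le[of s] s sub by (intro mult_right_mono) auto
  also have "\<dots> \<le> c * 1" using assms s by (intro mult_left_mono) auto
  finally have "t * ((N' s - K * N s) * exp (- K * s) - c) \<le> 0"
    using t by (intro mult_nonneg_nonpos) auto
  then have "g t \<le> g 0" using eq by simp
  then have "N t * exp (- K * t) \<le> N 0 + c * t" by (simp add: g_def)
  then have "N t * exp (- K * t) * exp (K * t) \<le> (N 0 + c * t) * exp (K * t)"
    by (intro mult_right_mono) auto
  then show ?thesis by (simp add: mult.assoc exp_add[symmetric])
qed

text \<open>The norm is not differentiable at 0, so the scalar inequality is applied to its square.
  Cauchy-Schwarz and \<open>2 * z * b \<le> z\<^sup>2 + b\<^sup>2\<close> give the rate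
  \<open>2 * L + 1\<close>, and the factor \<open>t\<close> is absorbed by \<open>exp t\<close>; the
  square root then has rate \<open>L + 1\<close>.\<close>

lemma gronwall_norm:
  fixes Z Z' :: "real \<Rightarrow> 'a::real_inner"
  assumes der: "\<And>s. s \<in> {0..T} \<Longrightarrow> (Z has_vector_derivative Z' s) (at s within {0..T})"
    and le: "\<And>s. s \<in> {0..T} \<Longrightarrow> norm (Z' s) \<le> L * norm (Z s) + b"
    and "0 \<le> L" "0 \<le> b" and t: "t \<in> {0..T}"
  shows "norm (Z t) \<le> (norm (Z 0) + b) * exp ((L + 1) * t)"
proof -
  have "(norm (Z t))\<^sup>2 \<le> ((norm (Z 0))\<^sup>2 + b\<^sup>2 * t) * exp ((2 * L + 1) * t)"
  proof (rule gronwall_real[where N = "\<lambda>s. (norm (Z s))\<^sup>2" and N' = "\<lambda>s. 2 * (Z s \<bullet> Z' s)"])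
    fix s assume s: "s \<in> {0..T}"
    show "((\<lambda>s. (norm (Z s))\<^sup>2) has_real_derivative 2 * (Z s \<bullet> Z' s)) (at s within {0..T})"
      unfolding power2_norm_eq_inner has_field_derivative_def
      using der[OF s] unfolding has_vector_derivative_def
      by (auto intro!: derivative_eq_intros simp: fun_eq_iff inner_commute algebra_simps)
    have "Z s \<bullet> Z' s \<le> norm (Z s) * norm (Z' s)" by (rule norm_cauchy_schwarz)
    also have "\<dots> \<le> norm (Z s) * (L * norm (Z s) + b)"
      by (intro mult_left_mono le s) auto
    also have "2 * \<dots> \<le> (2 * L + 1) * (norm (Z s))\<^sup>2 + b\<^sup>2"
      using sum_squares_bound[of "norm (Z s)" b] by (simp add: power2_eq_square algebra_simps)
    finally show "2 * (Z s \<bullet> Z' s) \<le> (2 * L + 1) * (norm (Z s))\<^sup>2 + b\<^sup>2" by simp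
  qed (use assms in auto)
  also have "\<dots> \<le> ((norm (Z 0) + b)\<^sup>2 * exp t) * exp ((2 * L + 1) * t)"
  proof (intro mult_right_mono)
    have "(norm (Z 0))\<^sup>2 * 1 \<le> (norm (Z 0))\<^sup>2 * exp t" "b\<^sup>2 * t \<le> b\<^sup>2 * exp t"
      using t exp_ge_add_one_self[of t] by (intro mult_left_mono; simp del: exp_ge_add_one_self)+
    moreover have "0 \<le> 2 * norm (Z 0) * b * exp t" using assms by auto
    ultimately show "(norm (Z 0))\<^sup>2 + b\<^sup>2 * t \<le> (norm (Z 0) + b)\<^sup>2 * exp t"
      by (simp add: power2_sum algebra_simps)
  qed auto
  also have "\<dots> = ((norm (Z 0) + b) * exp ((L + 1) * t))\<^sup>2"
    by (simp add: power_mult_distrib exp_double[symmetric] mult.assoc exp_add[symmetric])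
       (simp add: algebra_simps)
  finally show ?thesis
    by (rule power2_le_imp_le) (use assms in auto)
qed

text \<open>The Picard map is a contraction for the sup norm of \<open>exp (- K t) X t\<close> with \<open>K = 2 (L + 1)\<close>.\<close>

lemma picard_lindelof_global:
  fixes F :: "real \<Rightarrow> 'a::banach \<Rightarrow> 'a"
  assumes "0 \<le> T" and cont: "continuous_on ({0..T} \<times> UNIV) (\<lambda>(t, x). F t x)"
    and lip: "\<And>t x y. t \<in> {0..T} \<Longrightarrow> norm (F t x - F t y) \<le> L * norm (x - y)"
    and "0 \<le> L"
  obtains X where "X 0 = x0"
    "\<And>t. t \<in> {0..T} \<Longrightarrow> (X has_vector_derivative F t (X t)) (at t within {0..T})"
proof -
  define K where "K = 2 * (L + 1)"
  have K: "0 < K" "L \<le> K / 2" using \<open>0 \<le> L\<close> by (auto simp: K_def)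
  \<comment> \<open>The Picard map in the rescaled unknown
    \<open>u t = exp (- K * t) *\<^sub>R X t\<close>, which turns the weighted norm of
    \<open>X\<close> into the plain sup norm of \<open>u\<close>.\<close>
  define Q where "Q u t = exp (- K * t) *\<^sub>R (x0 + integral {0..t} (\<lambda>s. F s (exp (K * s) *\<^sub>R u s)))"
    for u :: "real \<Rightarrow> 'a" and t
  have contF: "continuous_on {0..T} (\<lambda>s. F s (g s))" if "continuous_on {0..T} g" for g
  proof -
    have "continuous_on {0..T} (\<lambda>s. case (s, g s) of (t, x) \<Rightarrow> F t x)"
      by (rule continuous_on_compose2[OF cont]) (auto intro!: continuous_on_Pair continuous_on_id that)
    then show ?thesis by simp
  qed
  have contu: "continuous_on {0..T} (\<lambda>s. F s (exp (K * s) *\<^sub>R apply_bcontfun u s))"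
    for u :: "real \<Rightarrow>\<^sub>C 'a"
    by (intro contF continuous_intros) auto
  \<comment> \<open>The complete space used is that of bounded continuous functions on the whole
    line; clamping the time extends \<open>Q u\<close> from the interval to it.\<close>
  have "\<exists>g :: real \<Rightarrow>\<^sub>C 'a. \<forall>t. apply_bcontfun g t = Q (apply_bcontfun u) (clamp 0 T t)"
    for u :: "real \<Rightarrow>\<^sub>C 'a"
  proof -
    have "continuous_on (cbox 0 T) (Q (apply_bcontfun u))"
      unfolding Q_def cbox_interval
      by (intro continuous_intros indefinite_integral_continuous_1 integrable_continuous_real contu)
    from continuous_on_cbox_bcontfunE[OF this] show ?thesis by metis
  qed
  then obtain P :: "(real \<Rightarrow>\<^sub>C 'a) \<Rightarrow> (real \<Rightarrow>\<^sub>C 'a)"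
    where P: "\<And>u t. apply_bcontfun (P u) t = Q (apply_bcontfun u) (clamp 0 T t)" by metis
  have "\<exists>!u. P u = u"
  proof (rule banach_fix_type[where c = "1/2"], safe)
    fix u v :: "real \<Rightarrow>\<^sub>C 'a"
    show "dist (P u) (P v) \<le> 1 / 2 * dist u v"
    proof (rule dist_bound)
      fix t0 :: real
      define t where "t = clamp 0 T t0"
      have t: "t \<in> {0..T}"
        using clamp_in_interval[of 0 T t0] \<open>0 \<le> T\<close> by (simp add: t_def cbox_interval)
      then have sub: "{0..t} \<subseteq> {0..T}" by auto
      let ?d = "\<lambda>s. F s (exp (K * s) *\<^sub>R u s) - F s (exp (K * s) *\<^sub>R v s)"
      have iu: "(\<lambda>s. F s (exp (K * s) *\<^sub>R u s)) integrable_on {0..t}"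
        and iv: "(\<lambda>s. F s (exp (K * s) *\<^sub>R v s)) integrable_on {0..t}"
        by (auto intro!: integrable_continuous_real continuous_on_subset[OF contu] sub)
      have I: "((\<lambda>s. K / 2 * dist u v * exp (K * s)) has_integral
          (dist u v / 2 * exp (K * t) - dist u v / 2 * exp (K * 0))) {0..t}"
        by (rule fundamental_theorem_of_calculus)
           (use t in \<open>auto intro!: derivative_eq_intros
              simp: has_real_derivative_iff_has_vector_derivative[symmetric] algebra_simps\<close>)
      have "norm (integral {0..t} ?d) \<le> integral {0..t} (\<lambda>s. K / 2 * dist u v * exp (K * s))"
      proof (rule Henstock_Kurzweil_Integration.integral_norm_bound_integral)
        fix s assume "s \<in> {0..t}"
        then have s: "s \<in> {0..T}" using sub by auto
        have "norm (?d s) \<le> L * norm (exp (K * s) *\<^sub>R u s - exp (K * s) *\<^sub>R v s)" by (rule lip[OF s])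
        also have "\<dots> = L * (exp (K * s) * dist (u s) (v s))"
          by (simp add: dist_norm scaleR_diff_right[symmetric])
        also have "\<dots> \<le> K / 2 * (exp (K * s) * dist u v)"
          using K by (intro mult_mono dist_bounded) auto
        finally show "norm (?d s) \<le> K / 2 * dist u v * exp (K * s)" by (simp add: algebra_simps)
      qed (use iu iv I in \<open>auto intro: integrable_diff has_integral_integrable\<close>)
      also have "\<dots> \<le> dist u v / 2 * exp (K * t)"
        using integral_unique[OF I] by simp
      finally have le: "norm (integral {0..t} ?d) \<le> dist u v / 2 * exp (K * t)" .
      have "dist (P u t0) (P v t0) = exp (- K * t) * norm (integral {0..t} ?d)"
        using iu iv by (simp add: P t_def[symmetric] Q_def dist_norm scaleR_diff_right[symmetric]
            Henstock_Kurzweil_Integration.integral_diff)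
      also have "\<dots> \<le> exp (- K * t) * (dist u v / 2 * exp (K * t))"
        by (intro mult_left_mono le) auto
      also have "\<dots> = 1 / 2 * dist u v" by (simp add: exp_minus field_simps)
      finally show "dist (P u t0) (P v t0) \<le> 1 / 2 * dist u v" .
    qed
  qed auto
  then obtain u where u: "P u = u" by auto
  define X where "X t = x0 + integral {0..t} (\<lambda>s. F s (exp (K * s) *\<^sub>R u s))" for t
  have Xu: "X t = exp (K * t) *\<^sub>R u t" if "t \<in> {0..T}" for t
  proof -
    have "u t = Q u t" using P[of u t] u that by (simp add: cbox_interval)
    then show ?thesis by (simp add: Q_def X_def exp_minus)
  qed
  show ?thesis
  proof
    show "X 0 = x0" by (simp add: X_def)
    fix t assume t: "t \<in> {0..T}"
    show "(X has_vector_derivative F t (X t)) (at t within {0..T})"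
      unfolding Xu[OF t] unfolding X_def
      using integral_has_vector_derivative[OF contu t]
      by (auto intro!: derivative_eq_intros)
  qed
qed

section \<open>The flow near an equilibrium\<close>

text \<open>Compactness of a closed ball bounds both derivatives, and the mean value inequality
  turns the bound on the second into a Lipschitz constant of the first. What follows uses the
  smoothness of \<open>f\<close> in this quantitative form.\<close>

lemma C2_on_local_bounds:
  fixes f :: "'a::euclidean_space \<Rightarrow> 'b::real_normed_vector"
  assumes "open U" "C2_on f U"
  obtains D :: "'a \<Rightarrow> 'a \<Rightarrow>\<^sub>L 'b" where
    "\<And>x. x \<in> U \<Longrightarrow> (f has_derivative D x) (at x)"
    "\<And>p. p \<in> U \<Longrightarrow> \<exists>r>0. \<exists>C\<ge>0. \<exists>L\<ge>0. cball p r \<subseteq> U \<and> (\<forall>x\<in>cball p r. norm (D x) \<le> L) \<and>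
       (\<forall>x\<in>cball p r. \<forall>y\<in>cball p r. norm (D x - D y) \<le> C * norm (x - y))"
proof -
  from assms(2) obtain D :: "'a \<Rightarrow> 'a \<Rightarrow>\<^sub>L 'b" and D2 :: "'a \<Rightarrow> 'a \<Rightarrow>\<^sub>L ('a \<Rightarrow>\<^sub>L 'b)"
    where D: "\<And>x. x \<in> U \<Longrightarrow> (f has_derivative D x) (at x)"
      and D2: "\<And>x. x \<in> U \<Longrightarrow> (D has_derivative D2 x) (at x)"
      and cont: "continuous_on U D2" unfolding C2_on_def by blast
  show ?thesis
  proof (rule that[OF D])
    fix p assume "p \<in> U"
    then obtain r where r: "0 < r" "cball p r \<subseteq> U" using \<open>open U\<close> open_contains_cball by blast
    have contD: "continuous_on (cball p r) D"
      using D2 r(2) by (meson continuous_at_imp_continuous_on has_derivative_continuous subsetD)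
    have "bounded (D ` cball p r)" "bounded (D2 ` cball p r)"
      using contD continuous_on_subset[OF cont r(2)]
      by (auto intro!: compact_imp_bounded compact_continuous_image)
    then obtain L C where L: "\<And>x. x \<in> cball p r \<Longrightarrow> norm (D x) \<le> L"
      and C: "\<And>x. x \<in> cball p r \<Longrightarrow> norm (D2 x) \<le> C"
      unfolding bounded_iff by blast
    have pos: "0 \<le> L" "0 \<le> C"
      using order_trans[OF norm_ge_zero L[of p]] order_trans[OF norm_ge_zero C[of p]] r by auto
    have "norm (D x - D y) \<le> C * norm (x - y)" if "x \<in> cball p r" "y \<in> cball p r" for x y
    proof (rule differentiable_bound[OF convex_cball, of p r D "\<lambda>x. blinfun_apply (D2 x)"])
      show "(D has_derivative D2 z) (at z within cball p r)" if "z \<in> cball p r" for z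
        using D2 r that by (blast intro: has_derivative_at_withinI)
      show "onorm (D2 z) \<le> C" if "z \<in> cball p r" for z
        using C[OF that] by (simp add: norm_blinfun.rep_eq)
    qed (use that in auto)
    then show "\<exists>r>0. \<exists>C\<ge>0. \<exists>L\<ge>0. cball p r \<subseteq> U \<and> (\<forall>x\<in>cball p r. norm (D x) \<le> L) \<and>
       (\<forall>x\<in>cball p r. \<forall>y\<in>cball p r. norm (D x - D y) \<le> C * norm (x - y))"
      using r L pos by blast
  qed
qed

lemma lipschitz_cball_blinfun:
  fixes f :: "'a::real_normed_vector \<Rightarrow> 'b::real_normed_vector" and D :: "'a \<Rightarrow> 'a \<Rightarrow>\<^sub>L 'b"
  assumes "\<And>x. x \<in> cball p r \<Longrightarrow> (f has_derivative D x) (at x)"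
    and "\<And>x. x \<in> cball p r \<Longrightarrow> norm (D x) \<le> L"
    and "x \<in> cball p r" "y \<in> cball p r"
  shows "norm (f x - f y) \<le> L * norm (x - y)"
  by (rule differentiable_bound[OF convex_cball, of p r f "\<lambda>x. blinfun_apply (D x)"])
     (use assms in \<open>auto simp: norm_blinfun.rep_eq[symmetric] intro: has_derivative_at_withinI\<close>)

lemma C2_on_local_lipschitz:
  fixes f :: "'a::euclidean_space \<Rightarrow> 'b::real_normed_vector"
  assumes "open U" "C2_on f U"
  shows "local_lipschitz (UNIV :: real set) U (\<lambda>_. f)"
proof (rule local_lipschitzI)
  fix t :: real and p assume "p \<in> U"
  obtain D :: "'a \<Rightarrow> 'a \<Rightarrow>\<^sub>L 'b" where D: "\<And>x. x \<in> U \<Longrightarrow> (f has_derivative D x) (at x)"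
    and *: "\<And>p. p \<in> U \<Longrightarrow> \<exists>r>0. \<exists>C\<ge>0. \<exists>L\<ge>0. cball p r \<subseteq> U \<and> (\<forall>x\<in>cball p r. norm (D x) \<le> L) \<and>
       (\<forall>x\<in>cball p r. \<forall>y\<in>cball p r. norm (D x - D y) \<le> C * norm (x - y))"
    using C2_on_local_bounds[OF assms] by blast
  from *[OF \<open>p \<in> U\<close>] obtain r L where r: "0 < r" "0 \<le> L" "cball p r \<subseteq> U"
    and L: "\<And>x. x \<in> cball p r \<Longrightarrow> norm (D x) \<le> L" by blast
  have "norm (f x - f y) \<le> L * norm (x - y)" if "x \<in> cball p r" "y \<in> cball p r" for x y
    by (rule lipschitz_cball_blinfun[OF D L that]) (use r in auto)
  then have "L-lipschitz_on (cball p r \<inter> U) f"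
    using r by (intro lipschitz_onI) (auto simp: dist_norm)
  then show "\<exists>u>0. \<exists>L. \<forall>s\<in>cball t u \<inter> UNIV. L-lipschitz_on (cball p u \<inter> U) f"
    using r(1) by blast
qed

lemma has_vector_derivative_continuous_on:
  assumes "\<And>t. t \<in> S \<Longrightarrow> (x has_vector_derivative x' t) (at t within S)"
  shows "continuous_on S x"
  unfolding continuous_on_eq_continuous_within
  using assms has_vector_derivative_continuous by blast

lemma solution_on_unique:
  assumes lip: "local_lipschitz (UNIV :: real set) U (\<lambda>_. f)"
    and x: "solution_on f U x0 {0..T} x" and y: "solution_on f U x0 {0..T} y"
    and t: "t \<in> {0..T}"
  shows "x t = y t"
proof -
  have der: "(x has_vector_derivative f (x s)) (at s within {0..T})"
    "(y has_vector_derivative f (y s)) (at s within {0..T})" "x s \<in> U" "y s \<in> U"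
    if "s \<in> {0..T}" for s
    using x y that by (auto simp: solution_on_def)
  have cont: "continuous_on {0..T} x" "continuous_on {0..T} y"
    by (rule has_vector_derivative_continuous_on, erule der)+
  \<comment> \<open>Both orbits lie in the compact set \<open>S\<close>, which need not be convex;
    local Lipschitz continuity still provides one constant on all of it.\<close>
  define S where "S = x ` {0..T} \<union> y ` {0..T}"
  have "compact S" "S \<subseteq> U" using cont der by (auto simp: S_def intro!: compact_continuous_image)
  from local_lipschitz_compact_implies_lipschitz[OF local_lipschitz_subset[OF lip _ \<open>S \<subseteq> U\<close>] \<open>compact S\<close>,
      of "{0::real}"] obtain L where L: "L-lipschitz_on S f" by auto
  have "norm (x t - y t) \<le> (norm (x 0 - y 0) + 0) * exp ((L + 1) * t)"
  proof (rule gronwall_norm[of T _ "\<lambda>s. f (x s) - f (y s)"])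
    fix s assume s: "s \<in> {0..T}"
    show "((\<lambda>s. x s - y s) has_vector_derivative f (x s) - f (y s)) (at s within {0..T})"
      using der[OF s] by (intro has_vector_derivative_diff)
    show "norm (f (x s) - f (y s)) \<le> L * norm (x s - y s) + 0"
      using lipschitz_onD[OF L, of "x s" "y s"] s by (auto simp: S_def dist_norm)
  qed (use t lipschitz_on_nonneg[OF L] in auto)
  moreover have "x 0 = y 0" using x y by (simp add: solution_on_def)
  ultimately show ?thesis by simp
qed

lemma flow_eq:
  assumes "local_lipschitz (UNIV :: real set) U (\<lambda>_. f)" "0 \<le> T"
    and "solution_on f U x0 {0..T} x"
  shows "flow f U T x0 = x T"
  unfolding flow_def using assms solution_on_unique[OF assms(1)]
  by (intro the_equality) (auto simp: closed_segment_eq_real_ivl)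

text \<open>The constants \<open>L\<close> and \<open>C\<close> belong to one fixed ball. Smallness
  is always obtained by passing to a radius \<open>r \<le> \<rho>\<close>, on which the derivative
  varies from its value at \<open>xs\<close> by at most \<open>C * r\<close>.\<close>

locale C2_equilibrium =
  fixes f :: "real^2 \<Rightarrow> real^2" and U :: "(real^2) set" and xs :: "real^2"
    and D :: "real^2 \<Rightarrow> (real^2) \<Rightarrow>\<^sub>L (real^2)" and \<rho> C L :: real
  assumes lip: "local_lipschitz (UNIV :: real set) U (\<lambda>_. f)"
    and \<rho>: "0 < \<rho>" "cball xs \<rho> \<subseteq> U"
    and C: "0 \<le> C" and L: "0 \<le> L"
    and eq0: "f xs = 0"
    and deriv: "\<And>x. x \<in> cball xs \<rho> \<Longrightarrow> (f has_derivative D x) (at x)"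
    and D_bound: "\<And>x. x \<in> cball xs \<rho> \<Longrightarrow> norm (D x) \<le> L"
    and D_lip: "\<And>x y. x \<in> cball xs \<rho> \<Longrightarrow> y \<in> cball xs \<rho> \<Longrightarrow> norm (D x - D y) \<le> C * norm (x - y)"
begin

section \<open>Linearization, local existence and differentiability of the time-T map\<close>

lemma f_lip: "x \<in> cball xs \<rho> \<Longrightarrow> y \<in> cball xs \<rho> \<Longrightarrow> norm (f x - f y) \<le> L * norm (x - y)"
  using lipschitz_cball_blinfun[of xs \<rho> f D L] deriv D_bound by blast

lemma f_linearization:
  assumes "x \<in> cball xs \<rho>" "y \<in> cball xs \<rho>"
  shows "norm (f y - f x - D x (y - x)) \<le> C * (norm (y - x))\<^sup>2"
proof -
  have sub: "closed_segment x y \<subseteq> cball xs \<rho>"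
    using assms by (simp add: closed_segment_subset)
  have "norm (f y - f x - D x (y - x)) \<le> norm (y - x) * (C * norm (y - x))"
  proof (rule differentiable_bound_linearization[where S = "closed_segment x y" and f' = "\<lambda>x. blinfun_apply (D x)"])
    show "x + t *\<^sub>R (y - x) \<in> closed_segment x y" if "t \<in> {0..1}" for t
      using that by (auto simp: in_segment algebra_simps intro!: exI[of _ t])
    show "(f has_derivative D z) (at z within closed_segment x y)" if "z \<in> closed_segment x y" for z
      using deriv sub that by (blast intro: has_derivative_at_withinI)
    show "onorm (blinfun_apply (D z) - blinfun_apply (D x)) \<le> C * norm (y - x)" if "z \<in> closed_segment x y" for z
    proof -
      have "norm (D z - D x) \<le> C * norm (z - x)" using D_lip sub that assms by blast
      also have "\<dots> \<le> C * norm (y - x)"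
        using segment_bound(1)[OF that] C by (simp add: mult_left_mono)
      finally show ?thesis by (simp add: norm_blinfun.rep_eq minus_blinfun.rep_eq fun_diff_def)
    qed
  qed auto
  then show ?thesis by (simp add: power2_eq_square mult_ac)
qed

text \<open>Composing \<open>f\<close> with the nearest-point projection onto the ball makes it
  globally Lipschitz. As \<open>f\<close> vanishes at \<open>xs\<close>, Gronwall keeps the
  resulting solution in the ball, where the projection is the identity.\<close>

lemma solution_exists:
  assumes "0 \<le> T" "0 < r" "r \<le> \<rho>" "norm (x0 - xs) * exp ((L + 1) * T) \<le> r"
  obtains X where "solution_on f (cball xs r) x0 {0..T} X"
proof -
  define p where "p = closest_point (cball xs r)"
  have p_in: "p x \<in> cball xs r" for x
    using \<open>0 < r\<close> by (auto simp: p_def intro!: closest_point_in_set simp del: mem_cball)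
  have p_lip: "norm (p x - p y) \<le> norm (x - y)" for x y
    using closest_point_lipschitz[of "cball xs r" x y] \<open>0 < r\<close> by (auto simp: p_def dist_norm)
  have p_self: "p x = x" if "x \<in> cball xs r" for x
    using that by (simp add: p_def closest_point_self)
  have fp_lip: "norm (f (p x) - f (p y)) \<le> L * norm (x - y)" for x y
  proof -
    have "norm (f (p x) - f (p y)) \<le> L * norm (p x - p y)"
      using p_in[of x] p_in[of y] \<open>r \<le> \<rho>\<close> by (intro f_lip) auto
    also have "\<dots> \<le> L * norm (x - y)" using p_lip L by (intro mult_left_mono)
    finally show ?thesis .
  qed
  have "L-lipschitz_on UNIV (\<lambda>x. f (p x))"
    using fp_lip L by (auto intro!: lipschitz_onI simp: dist_norm)
  then have cont: "continuous_on UNIV (\<lambda>x. f (p x))" by (rule lipschitz_on_continuous_on)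
  have "continuous_on ({0..T} \<times> UNIV) (\<lambda>(t, x). f (p x))"
    unfolding case_prod_beta
    by (rule continuous_on_compose2[OF cont]) (auto intro: continuous_intros)
  from picard_lindelof_global[OF \<open>0 \<le> T\<close> this fp_lip L]
  obtain X where X0: "X 0 = x0"
    and X: "\<And>t. t \<in> {0..T} \<Longrightarrow> (X has_vector_derivative f (p (X t))) (at t within {0..T})" by blast
  have X_in: "X t \<in> cball xs r" if t: "t \<in> {0..T}" for t
  proof -
    have "norm (X t - xs) \<le> (norm (X 0 - xs) + 0) * exp ((L + 1) * t)"
    proof (rule gronwall_norm[where T = T and Z' = "\<lambda>s. f (p (X s))"])
      show "((\<lambda>s. X s - xs) has_vector_derivative f (p (X s))) (at s within {0..T})"
        if "s \<in> {0..T}" for s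
        using X[OF that] by (auto intro!: derivative_eq_intros)
      show "norm (f (p (X s))) \<le> L * norm (X s - xs) + 0" for s
        using fp_lip[of "X s" xs] p_self[of xs] \<open>0 < r\<close> eq0 by simp
    qed (use L t in auto)
    also have "\<dots> \<le> norm (x0 - xs) * exp ((L + 1) * T)"
      using t L X0 by (auto intro!: mult_left_mono)
    finally show ?thesis using assms by (simp add: dist_norm norm_minus_commute)
  qed
  show ?thesis
    using that[of X] X X_in X0 p_self by (auto simp: solution_on_def)
qed

text \<open>The derivative is the value at \<open>T\<close> of the solution of the variational
  equation along the orbit, an equation for operators. The orbit stays within \<open>r\<close> of
  \<open>xs\<close>, so the coefficients differ from \<open>D xs\<close> by at most
  \<open>C * r\<close>, and Gronwall compares with any solution \<open>w\<close> of the
  constant-coefficient equation.\<close>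

lemma
  assumes "0 \<le> T" "0 < r" "r \<le> \<rho>" "norm (x0 - xs) * exp ((L + 1) * T) < r"
  shows mem_X0: "x0 \<in> X0 f U T"
    and flow_has_derivative: "\<exists>M :: (real^2) \<Rightarrow>\<^sub>L (real^2). (flow f U T has_derivative M) (at x0) \<and>
      (\<forall>h w. w 0 = h \<longrightarrow> (\<forall>t\<in>{0..T}. (w has_vector_derivative D xs (w t)) (at t within {0..T})) \<longrightarrow>
        norm (M h - w T) \<le> C * r * (exp ((L + 1) * T))\<^sup>2 * norm h)"
proof -
  define G where "G = exp ((L + 1) * T)"
  have G: "1 \<le> G" using L \<open>0 \<le> T\<close> by (simp add: G_def)
  have GT: "exp ((L + 1) * t) \<le> G" if "t \<in> {0..T}" for t
    using that L by (simp add: G_def mult_left_mono)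
  have sub: "cball xs r \<subseteq> cball xs \<rho>" using assms by auto
  have sol: "solution_on f U x {0..T} X" if "solution_on f (cball xs r) x {0..T} X" for x X
    using that subset_trans[OF sub \<rho>(2)] by (auto simp: solution_on_def simp del: mem_cball)
  obtain X where X: "solution_on f (cball xs r) x0 {0..T} X"
    using solution_exists[of T r x0] assms by auto
  have X_in: "X t \<in> cball xs \<rho>" "norm (X t - xs) \<le> r" if "t \<in> {0..T}" for t
    using X that \<open>r \<le> \<rho>\<close> by (force simp: solution_on_def dist_norm norm_minus_commute)+
  have dX: "(X has_vector_derivative f (X t)) (at t within {0..T})" if "t \<in> {0..T}" for t
    using X that by (auto simp: solution_on_def)
  have "x0 \<in> cball xs r" using X assms by (force simp: solution_on_def)
  then show "x0 \<in> X0 f U T" using sol[OF X] sub \<rho>(2) by (auto simp: X0_def)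
  have "C-lipschitz_on (cball xs \<rho>) D"
    using D_lip C by (auto intro!: lipschitz_onI simp: dist_norm)
  then have "continuous_on (cball xs \<rho>) D" by (rule lipschitz_on_continuous_on)
  moreover have "continuous_on {0..T} X"
    using dX by (rule has_vector_derivative_continuous_on)
  ultimately have contD: "continuous_on {0..T} (\<lambda>t. D (X t))"
    by (rule continuous_on_compose2) (use X_in in auto)
  have "continuous_on ({0..T} \<times> UNIV) (\<lambda>(t, N :: (real^2) \<Rightarrow>\<^sub>L (real^2)). D (X t) o\<^sub>L N)"
    unfolding case_prod_beta
    by (intro bounded_bilinear.continuous_on[OF bounded_bilinear_blinfun_compose]
          continuous_on_compose2[OF contD] continuous_intros) auto
  moreover have "norm ((D (X t) o\<^sub>L N) - (D (X t) o\<^sub>L N')) \<le> L * norm (N - N')"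
    if "t \<in> {0..T}" for t and N N' :: "(real^2) \<Rightarrow>\<^sub>L (real^2)"
  proof -
    have "(D (X t) o\<^sub>L N) - (D (X t) o\<^sub>L N') = D (X t) o\<^sub>L (N - N')"
      by (rule bounded_bilinear.diff_right[OF bounded_bilinear_blinfun_compose, symmetric])
    also have "norm \<dots> \<le> norm (D (X t)) * norm (N - N')" by (rule norm_blinfun_compose)
    also have "\<dots> \<le> L * norm (N - N')" using D_bound X_in that by (intro mult_right_mono) auto
    finally show ?thesis .
  qed
  ultimately obtain M :: "real \<Rightarrow> (real^2) \<Rightarrow>\<^sub>L (real^2)" where M0: "M 0 = id_blinfun"
    and dM: "\<And>t. t \<in> {0..T} \<Longrightarrow> (M has_vector_derivative (D (X t) o\<^sub>L M t)) (at t within {0..T})"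
    using picard_lindelof_global[OF \<open>0 \<le> T\<close> _ _ L, where ?x0.0 = id_blinfun
        and F = "\<lambda>t N. D (X t) o\<^sub>L N"] by blast
  have dMh: "((\<lambda>t. M t h) has_vector_derivative D (X t) (M t h)) (at t within {0..T})"
    if "t \<in> {0..T}" for t h
    using bounded_linear.has_vector_derivative[OF bounded_linear_apply_blinfun dM[OF that], of h] by simp
  have DX: "norm (D (X t) h) \<le> L * norm h" if "t \<in> {0..T}" for t h
    using norm_blinfun[of "D (X t)" h] D_bound[OF X_in(1)[OF that]] mult_right_mono[of _ L "norm h"]
    by (meson norm_ge_zero order_trans)
  have Mh: "norm (M t h) \<le> norm h * G" if t: "t \<in> {0..T}" for t h
  proof -
    have "norm (M t h) \<le> (norm (M 0 h) + 0) * exp ((L + 1) * t)"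
      by (rule gronwall_norm[where T = T, OF dMh]) (use DX L t in auto)
    also have "\<dots> \<le> norm h * G" using GT[OF t] by (simp add: M0 mult_left_mono)
    finally show ?thesis .
  qed
  have "norm (M T h - w T) \<le> C * r * G\<^sup>2 * norm h"
    if w: "w 0 = h" "\<And>t. t \<in> {0..T} \<Longrightarrow> (w has_vector_derivative D xs (w t)) (at t within {0..T})" for h w
  proof -
    have "norm (M T h - w T) \<le> (norm (M 0 h - w 0) + C * r * G * norm h) * exp ((L + 1) * T)"
    proof (rule gronwall_norm[where T = T and Z' = "\<lambda>t. D (X t) (M t h) - D xs (w t)"])
      fix t assume t: "t \<in> {0..T}"
      show "((\<lambda>t. M t h - w t) has_vector_derivative D (X t) (M t h) - D xs (w t)) (at t within {0..T})"
        by (intro has_vector_derivative_diff dMh w t)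
      have "D (X t) (M t h) - D xs (w t) = D xs (M t h - w t) + (D (X t) - D xs) (M t h)"
        by (simp add: blinfun.bilinear_simps)
      also have "norm \<dots> \<le> norm (D xs) * norm (M t h - w t) + norm (D (X t) - D xs) * norm (M t h)"
        by (intro norm_triangle_le add_mono norm_blinfun)
      also have "\<dots> \<le> L * norm (M t h - w t) + (C * r) * (norm h * G)"
      proof (intro add_mono mult_mono Mh t)
        show "norm (D xs) \<le> L" using D_bound \<rho> by simp
        have "norm (D (X t) - D xs) \<le> C * norm (X t - xs)" using D_lip X_in[OF t] \<rho> by simp
        also have "\<dots> \<le> C * r" using X_in[OF t] C by (intro mult_left_mono)
        finally show "norm (D (X t) - D xs) \<le> C * r" .
      qed (use L C assms in auto)
      finally show "norm (D (X t) (M t h) - D xs (w t)) \<le> L * norm (M t h - w t) + C * r * G * norm h"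
        by (simp add: mult_ac)
    qed (use L C G assms in auto)
    then show ?thesis by (simp add: M0 w G_def power2_eq_square mult_ac)
  qed
  moreover have "(flow f U T has_derivative M T) (at x0)"
  proof -
    \<comment> \<open>For \<open>y\<close> in this ball the solution still exists up to
      \<open>T\<close> inside \<open>cball xs r\<close>. The radius is positive because the
      hypothesis on \<open>x0\<close> is strict.\<close>
    define S where "S = ball x0 (r / G - norm (x0 - xs))"
    have S: "x0 \<in> S" "open S" using assms G by (auto simp: S_def G_def field_simps)
    have est: "norm (flow f U T y - flow f U T x0 - M T (y - x0)) \<le> C * G ^ 3 * (norm (y - x0))\<^sup>2"
      if "y \<in> S" for y
    proof -
      have "norm (y - xs) \<le> norm (y - x0) + norm (x0 - xs)" by norm
      also have "\<dots> \<le> r / G" using that by (simp add: S_def dist_norm norm_minus_commute)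
      finally have "norm (y - xs) * exp ((L + 1) * T) \<le> r" using G by (simp add: field_simps G_def)
      with assms obtain Y where Y: "solution_on f (cball xs r) y {0..T} Y"
        using solution_exists[of T r y] by auto
      have Y_in: "Y t \<in> cball xs \<rho>" if "t \<in> {0..T}" for t
        using Y that \<open>r \<le> \<rho>\<close> by (force simp: solution_on_def)
      have dY: "(Y has_vector_derivative f (Y t)) (at t within {0..T})" if "t \<in> {0..T}" for t
        using Y that by (auto simp: solution_on_def)
      have 0: "X 0 = x0" "Y 0 = y" using X Y by (auto simp: solution_on_def)
      have YX: "norm (Y t - X t) \<le> norm (y - x0) * G" if t: "t \<in> {0..T}" for t
      proof -
        have "norm (Y t - X t) \<le> (norm (Y 0 - X 0) + 0) * exp ((L + 1) * t)"
          by (rule gronwall_norm[where T = T, OF has_vector_derivative_diff[OF dY dX]])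
             (use L t f_lip[OF Y_in X_in(1)] in auto)
        also have "\<dots> \<le> norm (y - x0) * G" using GT[OF t] 0 by (simp add: mult_left_mono)
        finally show ?thesis .
      qed
      \<comment> \<open>The difference \<open>Y t - X t - M t (y - x0)\<close> starts at 0 and
        solves the variational equation up to the Taylor remainder of \<open>f\<close>, which
        \<open>b\<close> bounds; being quadratic in \<open>y - x0\<close>, it yields
        differentiability.\<close>
      define b where "b = C * (norm (y - x0) * G)\<^sup>2"
      have "norm (Y T - X T - M T (y - x0)) \<le> (norm (Y 0 - X 0 - M 0 (y - x0)) + b) * exp ((L + 1) * T)"
      proof (rule gronwall_norm[where T = T, OF has_vector_derivative_diff[OF has_vector_derivative_diff[OF dY dX] dMh]])
        fix t assume t: "t \<in> {0..T}"
        have "f (Y t) - f (X t) - D (X t) (M t (y - x0)) =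
          D (X t) (Y t - X t - M t (y - x0)) + (f (Y t) - f (X t) - D (X t) (Y t - X t))"
          by (simp add: blinfun.bilinear_simps)
        also have "norm \<dots> \<le> L * norm (Y t - X t - M t (y - x0)) + C * (norm (Y t - X t))\<^sup>2"
          by (intro norm_triangle_le add_mono DX t f_linearization Y_in X_in)
        also have "C * (norm (Y t - X t))\<^sup>2 \<le> b"
          unfolding b_def using C YX[OF t] by (intro mult_left_mono power_mono) auto
        finally show "norm (f (Y t) - f (X t) - D (X t) (M t (y - x0))) \<le> L * norm (Y t - X t - M t (y - x0)) + b"
          by simp
      qed (use assms L C in \<open>auto simp: b_def\<close>)
      moreover have "flow f U T x0 = X T" "flow f U T y = Y T"
        using flow_eq[OF lip \<open>0 \<le> T\<close> sol[OF X]] flow_eq[OF lip \<open>0 \<le> T\<close> sol[OF Y]] by auto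
      ultimately show ?thesis
        unfolding G_def[symmetric]
        by (simp add: 0 M0 b_def power_mult_distrib power3_eq_cube power2_eq_square mult_ac)
    qed
    show ?thesis
      unfolding has_derivative_within_alt2
    proof (intro conjI allI impI)
      show "bounded_linear (M T)" by (rule blinfun.bounded_linear_right)
      fix e :: real assume "0 < e"
      have "((\<lambda>y. C * G ^ 3 * norm (y - x0)) \<longlongrightarrow> C * G ^ 3 * norm (x0 - x0)) (at x0)"
        by (intro tendsto_intros)
      then have "\<forall>\<^sub>F y in at x0. C * G ^ 3 * norm (y - x0) < e"
        using \<open>0 < e\<close> by (auto dest!: order_tendstoD(2)[where a = e])
      moreover have "\<forall>\<^sub>F y in at x0. y \<in> S" using S by (simp add: eventually_at_in_open')
      ultimately show "\<forall>\<^sub>F y in at x0. norm (flow f U T y - flow f U T x0 - M T (y - x0)) \<le> e * norm (y - x0)"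
      proof eventually_elim
        case (elim y)
        have "C * G ^ 3 * (norm (y - x0))\<^sup>2 \<le> e * norm (y - x0)"
          using mult_right_mono[OF less_imp_le[OF elim(1)], of "norm (y - x0)"]
          by (simp add: power2_eq_square mult_ac)
        with est[OF elim(2)] show ?case by linarith
      qed
    qed
  qed
  ultimately show "\<exists>M :: (real^2) \<Rightarrow>\<^sub>L (real^2). (flow f U T has_derivative M) (at x0) \<and>
      (\<forall>h w. w 0 = h \<longrightarrow> (\<forall>t\<in>{0..T}. (w has_vector_derivative D xs (w t)) (at t within {0..T})) \<longrightarrow>
        norm (M h - w T) \<le> C * r * (exp ((L + 1) * T))\<^sup>2 * norm h)"
    unfolding G_def by blast
qed

end

section \<open>Cones and invariant manifolds of a saddle\<close>

text \<open>The quadratic form \<open>W = u\<^sup>2 - k\<^sup>2 v\<^sup>2\<close> satisfies \<open>W' \<ge> m W\<close>, so if it is positive initially it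
  grows exponentially, which bounded \<open>u\<close> forbids.\<close>

lemma saddle_cone_estimate:
  fixes u v u' v' :: "real \<Rightarrow> real"
  assumes du: "\<And>t. 0 \<le> t \<Longrightarrow> (u has_real_derivative u' t) (at t within {0..})"
    and dv: "\<And>t. 0 \<le> t \<Longrightarrow> (v has_real_derivative v' t) (at t within {0..})"
    and u': "\<And>t. 0 \<le> t \<Longrightarrow> \<bar>u' t - a * u t\<bar> \<le> c * (\<bar>u t\<bar> + \<bar>v t\<bar>)"
    and v': "\<And>t. 0 \<le> t \<Longrightarrow> \<bar>v' t - b * v t\<bar> \<le> c * (\<bar>u t\<bar> + \<bar>v t\<bar>)"
    and m: "0 < m" "m \<le> a" "b \<le> - m"
    and k: "0 < k" "k \<le> 1" "0 \<le> c" "4 * c \<le> m * k"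
    and bnd: "\<And>t. 0 \<le> t \<Longrightarrow> \<bar>u t\<bar> \<le> B"
  shows "\<bar>u 0\<bar> \<le> k * \<bar>v 0\<bar>"
proof (rule ccontr)
  define W where "W t = (u t)\<^sup>2 - (k * v t)\<^sup>2" for t
  assume "\<not> \<bar>u 0\<bar> \<le> k * \<bar>v 0\<bar>"
  then have "\<bar>k * v 0\<bar> < \<bar>u 0\<bar>" using k by (simp add: abs_mult)
  then have W0: "0 < W 0" using power_strict_mono[OF \<open>\<bar>k * v 0\<bar> < \<bar>u 0\<bar>\<close>, of 2] by (simp add: W_def)
  \<comment> \<open>Chosen so that \<open>W 0 * (1 + m * T)\<close> equals
    \<open>W 0 + B\<^sup>2\<close>, which exceeds every possible value of
    \<open>(u T)\<^sup>2\<close>.\<close>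
  define T where "T = B\<^sup>2 / (W 0 * m)"
  have T: "0 \<le> T" using W0 m by (simp add: T_def)
  have "- W T \<le> (- W 0 + 0 * T) * exp (m * T)"
  proof (rule gronwall_real[where T = T and N' = "\<lambda>t. - (2 * u t * u' t - 2 * k\<^sup>2 * v t * v' t)"])
    fix t assume "t \<in> {0..T}"
    then have t: "0 \<le> t" and sub: "{0..T} \<subseteq> {0..}" by auto
    show "((\<lambda>t. - W t) has_real_derivative - (2 * u t * u' t - 2 * k\<^sup>2 * v t * v' t)) (at t within {0..T})"
      unfolding W_def
      by (rule derivative_eq_intros DERIV_subset[OF du[OF t] sub] DERIV_subset[OF dv[OF t] sub] refl)+
         (simp add: power2_eq_square algebra_simps)
    let ?p = "\<bar>u t\<bar>" and ?r = "\<bar>v t\<bar>"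
    have 1: "u t * (u' t - a * u t) \<ge> - (?p * (c * (?p + ?r)))"
      using mult_left_mono[OF u'[OF t], of ?p] by (simp add: abs_mult[symmetric])
    have 2: "v t * (v' t - b * v t) \<le> ?r * (c * (?p + ?r))"
      using mult_left_mono[OF v'[OF t], of ?r] by (simp add: abs_mult[symmetric])
    have 3: "a * (u t)\<^sup>2 \<ge> m * ?p\<^sup>2" "b * (v t)\<^sup>2 \<le> - m * ?r\<^sup>2"
      unfolding power2_abs using m by (intro mult_right_mono; simp)+
    \<comment> \<open>This is where \<open>4 * c \<le> m * k\<close> comes from: the coupling errors
      use up at most half of the diagonal growth
      \<open>2 * m * (?p\<^sup>2 + k\<^sup>2 * ?r\<^sup>2)\<close>.\<close>
    have 4: "k * ((?p + ?r) * (?p + k\<^sup>2 * ?r)) \<le> 2 * (?p\<^sup>2 + k\<^sup>2 * ?r\<^sup>2)"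
    proof -
      have "k * ?p\<^sup>2 \<le> ?p\<^sup>2" "k * (k\<^sup>2 * ?r\<^sup>2) \<le> k\<^sup>2 * ?r\<^sup>2"
        "(k * k\<^sup>2) * (?p * ?r) \<le> k * (?p * ?r)"
        using k by (auto intro!: mult_left_le_one_le mult_right_mono mult_left_le simp: power_le_one)
      moreover have "2 * k * (?p * ?r) \<le> ?p\<^sup>2 + k\<^sup>2 * ?r\<^sup>2"
        using sum_squares_bound[of ?p "k * ?r"] by (simp add: power_mult_distrib mult_ac)
      ultimately show ?thesis by (simp add: power2_eq_square algebra_simps)
    qed
    have "4 * c * ((?p + ?r) * (?p + k\<^sup>2 * ?r)) \<le> m * k * ((?p + ?r) * (?p + k\<^sup>2 * ?r))"
      using k by (intro mult_right_mono) auto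
    also have "\<dots> \<le> m * (2 * (?p\<^sup>2 + k\<^sup>2 * ?r\<^sup>2))"
      unfolding mult.assoc using m by (intro mult_left_mono 4[unfolded mult.assoc]) auto
    also have "\<dots> = 2 * (m * (?p\<^sup>2 + k\<^sup>2 * ?r\<^sup>2))" by (simp only: mult.left_commute)
    finally have 5: "2 * c * ((?p + ?r) * (?p + k\<^sup>2 * ?r)) \<le> m * (?p\<^sup>2 + k\<^sup>2 * ?r\<^sup>2)" by linarith
    have 6: "k\<^sup>2 * (v t * (v' t - b * v t)) \<le> k\<^sup>2 * (?r * (c * (?p + ?r)))"
      by (intro mult_left_mono 2) auto
    have 7: "k\<^sup>2 * (b * (v t)\<^sup>2) \<le> k\<^sup>2 * (- m * ?r\<^sup>2)"
      by (intro mult_left_mono 3) auto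
    have "m * (?p\<^sup>2 - k\<^sup>2 * ?r\<^sup>2) \<le> 2 * u t * u' t - 2 * k\<^sup>2 * v t * v' t"
    proof -
      have "0 \<le> m * (k\<^sup>2 * ?r\<^sup>2)" using m by simp
      then show ?thesis
        using 1 6 3(1) 7 5 by (simp add: power2_eq_square algebra_simps)
    qed
    then show "- (2 * u t * u' t - 2 * k\<^sup>2 * v t * v' t) \<le> m * - W t + 0"
      by (simp add: W_def power_mult_distrib algebra_simps)
  qed (use m T in auto)
  then have "W 0 * exp (m * T) \<le> W T" by simp
  moreover have "W 0 * (1 + m * T) \<le> W 0 * exp (m * T)" using W0 by (intro mult_left_mono) auto
  moreover have "W 0 * (1 + m * T) = W 0 + B\<^sup>2" using W0 m by (simp add: T_def field_simps)
  moreover have "W T \<le> \<bar>u T\<bar>\<^sup>2" by (simp add: W_def)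
  moreover have "\<bar>u T\<bar>\<^sup>2 \<le> B\<^sup>2" using bnd[OF T] by (intro power_mono) auto
  ultimately show False using W0 by linarith
qed

section \<open>Eigencoordinates of the linearization\<close>

locale C2_saddle = C2_equilibrium f U xs D \<rho> C L
  for f :: "real^2 \<Rightarrow> real^2" and U :: "(real^2) set" and xs :: "real^2"
    and D :: "real^2 \<Rightarrow> (real^2) \<Rightarrow>\<^sub>L (real^2)" and \<rho> C L :: real +
  fixes e1 e2 :: "real^2" and l1 l2 :: real
  assumes l1: "0 < l1" and l2: "l2 < 0"
    and e1: "norm e1 = 1" "D xs e1 = l1 *\<^sub>R e1"
    and e2: "norm e2 = 1" "D xs e2 = l2 *\<^sub>R e2"
begin

definition s0 :: real where "s0 = sqrt (1 - (e1 \<bullet> e2)\<^sup>2)"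

text \<open>The basis dual to \<open>e1\<close>, \<open>e2\<close>; both vectors have norm \<open>1 / s0\<close>, where \<open>s0\<close> is the sine of the angle
  between the eigenvectors.\<close>

definition q1 :: "real^2" where "q1 = (e1 - (e1 \<bullet> e2) *\<^sub>R e2) /\<^sub>R s0\<^sup>2"

definition q2 :: "real^2" where "q2 = (e2 - (e1 \<bullet> e2) *\<^sub>R e1) /\<^sub>R s0\<^sup>2"

lemma inner_eigenvectors [simp]: "e1 \<bullet> e1 = 1" "e2 \<bullet> e2 = 1" "e2 \<bullet> e1 = e1 \<bullet> e2"
  using e1 e2 by (simp_all add: norm_eq_1 inner_commute)

text \<open>The operator \<open>D xs - l2\<close> annihilates \<open>e2\<close> and multiplies
  \<open>e1\<close> by \<open>l1 - l2\<close>, which is nonzero.\<close>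

lemma eigenvectors_independent: "a *\<^sub>R e1 + b *\<^sub>R e2 = 0 \<Longrightarrow> a = 0 \<and> b = 0"
proof -
  assume 0: "a *\<^sub>R e1 + b *\<^sub>R e2 = 0"
  then have "D xs (a *\<^sub>R e1 + b *\<^sub>R e2) - l2 *\<^sub>R (a *\<^sub>R e1 + b *\<^sub>R e2) = 0" by simp
  also have "D xs (a *\<^sub>R e1 + b *\<^sub>R e2) - l2 *\<^sub>R (a *\<^sub>R e1 + b *\<^sub>R e2) = ((l1 - l2) * a) *\<^sub>R e1"
    by (simp add: blinfun.bilinear_simps e1 e2 algebra_simps)
  finally have "a = 0" using e1 l1 l2 by auto
  with 0 show ?thesis using e2 by auto
qed

text \<open>The component of \<open>e1\<close> orthogonal to \<open>e2\<close> is nonzero by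
  independence, and its squared norm is \<open>1 - (e1 \<bullet> e2)\<^sup>2\<close>.\<close>

lemma inner_less_1: "(e1 \<bullet> e2)\<^sup>2 < 1"
proof -
  have "norm (e1 - (e1 \<bullet> e2) *\<^sub>R e2) \<noteq> 0"
    using eigenvectors_independent[of 1 "- (e1 \<bullet> e2)"] by auto
  then have "0 < (norm (e1 - (e1 \<bullet> e2) *\<^sub>R e2))\<^sup>2" by simp
  then show ?thesis
    unfolding power2_norm_eq_inner by (simp add: inner_diff power2_eq_square)
qed

lemma s0: "0 < s0" "s0 \<le> 1" "s0\<^sup>2 = 1 - (e1 \<bullet> e2)\<^sup>2"
  using inner_less_1 by (auto simp: s0_def)

lemma dual_eigenvectors [simp]: "q1 \<bullet> e1 = 1" "q1 \<bullet> e2 = 0" "q2 \<bullet> e1 = 0" "q2 \<bullet> e2 = 1"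
proof -
  have "1 - (e1 \<bullet> e2) * (e1 \<bullet> e2) \<noteq> 0" using inner_less_1 by (simp add: power2_eq_square)
  then show "q1 \<bullet> e1 = 1" "q1 \<bullet> e2 = 0" "q2 \<bullet> e1 = 0" "q2 \<bullet> e2 = 1"
    unfolding q1_def q2_def s0 by (auto simp: inner_diff power2_eq_square)
qed

lemma norm_dual: "norm q1 = 1 / s0" "norm q2 = 1 / s0"
proof -
  \<comment> \<open>Only the right factor is expanded, so that the duality relations evaluate the
    product at once.\<close>
  have "q1 \<bullet> q1 = q1 \<bullet> ((e1 - (e1 \<bullet> e2) *\<^sub>R e2) /\<^sub>R s0\<^sup>2)"
    "q2 \<bullet> q2 = q2 \<bullet> ((e2 - (e1 \<bullet> e2) *\<^sub>R e1) /\<^sub>R s0\<^sup>2)"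
    by (simp_all only: q1_def[symmetric] q2_def[symmetric])
  then have "(norm q1)\<^sup>2 = (1 / s0)\<^sup>2" "(norm q2)\<^sup>2 = (1 / s0)\<^sup>2"
    unfolding power2_norm_eq_inner by (simp_all add: inner_diff_right power_divide inverse_eq_divide)
  then show "norm q1 = 1 / s0" "norm q2 = 1 / s0"
    using s0(1) by (auto intro: power2_eq_imp_eq)
qed

lemma dual_le_norm: "\<bar>q1 \<bullet> z\<bar> \<le> norm z / s0" "\<bar>q2 \<bullet> z\<bar> \<le> norm z / s0"
  using Cauchy_Schwarz_ineq2[of q1 z] Cauchy_Schwarz_ineq2[of q2 z] by (simp_all add: norm_dual)

lemma eigen_decomposition: "z = (q1 \<bullet> z) *\<^sub>R e1 + (q2 \<bullet> z) *\<^sub>R e2"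
proof -
  have ne: "e1 \<noteq> e2" using eigenvectors_independent[of 1 "-1"] by auto
  have "e1 \<noteq> k *\<^sub>R e2" for k using eigenvectors_independent[of 1 "- k"] by auto
  then have "independent {e1, e2}" using e2 by (auto simp: independent_insert span_singleton)
  then have "UNIV \<subseteq> span {e1, e2}"
    using ne by (intro card_ge_dim_independent) auto
  then have "z \<in> span {e1, e2}" by auto
  then obtain a b where "z - a *\<^sub>R e1 = b *\<^sub>R e2"
    by (auto simp: span_insert span_singleton)
  then have "z = a *\<^sub>R e1 + b *\<^sub>R e2" by (simp add: algebra_simps)
  then show ?thesis by (simp add: inner_add_right)
qed

lemma norm_le_dual_sum: "norm z \<le> \<bar>q1 \<bullet> z\<bar> + \<bar>q2 \<bullet> z\<bar>"
  using norm_triangle_ineq[of "(q1 \<bullet> z) *\<^sub>R e1" "(q2 \<bullet> z) *\<^sub>R e2"] eigen_decomposition[of z] e1 e2 by simp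

lemma dual_derivative: "q1 \<bullet> D xs z = l1 * (q1 \<bullet> z)" "q2 \<bullet> D xs z = l2 * (q2 \<bullet> z)"
  by (subst eigen_decomposition[of z], simp add: blinfun.bilinear_simps e1 e2 inner_add_right)+

text \<open>The component of \<open>z\<close> orthogonal to \<open>e2\<close> comes from
  \<open>(q1 \<bullet> z) *\<^sub>R e1\<close> alone and has length
  \<open>s0 * \<bar>q1 \<bullet> z\<bar>\<close>. Membership in either cone thereby becomes an
  inequality between \<open>\<bar>q1 \<bullet> z\<bar>\<close> and \<open>norm z\<close>.\<close>

lemma sin_vec_angle: "z \<noteq> 0 \<Longrightarrow> sin \<bar>vec_angle (z /\<^sub>R norm z) e2\<bar> = s0 * \<bar>q1 \<bullet> z\<bar> / norm z"
proof -
  assume "z \<noteq> 0"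
  define c where "c = (z /\<^sub>R norm z) \<bullet> e2"
  have c: "\<bar>c\<bar> \<le> 1" using Cauchy_Schwarz_ineq2[of "z /\<^sub>R norm z" e2] \<open>z \<noteq> 0\<close> e2 by (simp add: c_def)
  then have "vec_angle (z /\<^sub>R norm z) e2 = arccos c" "0 \<le> arccos c"
    using \<open>z \<noteq> 0\<close> e2 by (auto simp: vec_angle_def c_def intro: arccos_lbound)
  then have "sin \<bar>vec_angle (z /\<^sub>R norm z) e2\<bar> = sqrt (1 - c\<^sup>2)"
    using c by (simp add: sin_arccos_abs)
  also have "1 - c\<^sup>2 = (s0 * \<bar>q1 \<bullet> z\<bar> / norm z)\<^sup>2"
  proof -
    define u v where "u = q1 \<bullet> z" and "v = q2 \<bullet> z"
    have z: "z = u *\<^sub>R e1 + v *\<^sub>R e2" using eigen_decomposition[of z] by (simp add: u_def v_def)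
    have "z \<bullet> z - (z \<bullet> e2)\<^sup>2 = s0\<^sup>2 * u\<^sup>2"
      unfolding z s0(3) by (simp add: inner_add power2_eq_square algebra_simps)
    then have "(norm z)\<^sup>2 - (z \<bullet> e2)\<^sup>2 = (s0 * \<bar>q1 \<bullet> z\<bar>)\<^sup>2"
      by (simp add: power2_norm_eq_inner u_def power_mult_distrib)
    moreover have "1 - c\<^sup>2 = ((norm z)\<^sup>2 - (z \<bullet> e2)\<^sup>2) / (norm z)\<^sup>2"
      using \<open>z \<noteq> 0\<close> by (simp add: c_def field_simps)
    ultimately show ?thesis by (simp only: power_divide)
  qed
  finally show ?thesis using s0 by simp
qed

text \<open>The distance of the two eigenvalues from the imaginary axis: a single rate valid in both
  eigendirections and invariant under time reversal.\<close>

definition m :: real where "m = min l1 (- l2)"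

lemma m: "0 < m" "m \<le> l1" "l2 \<le> - m"
  using l1 l2 by (auto simp: m_def)

text \<open>The radius \<open>r\<close> turns the quadratic Taylor remainder into a linear error
  with small coefficient; the division by \<open>s0\<close> is the norm of the dual vectors.\<close>

lemma dual_f_estimate:
  assumes "x \<in> cball xs \<rho>" "norm (x - xs) \<le> r"
  shows "\<bar>q1 \<bullet> f x - l1 * (q1 \<bullet> (x - xs))\<bar> \<le> C * r / s0 * norm (x - xs)"
    and "\<bar>q2 \<bullet> f x - l2 * (q2 \<bullet> (x - xs))\<bar> \<le> C * r / s0 * norm (x - xs)"
proof -
  have "norm (f x - D xs (x - xs)) \<le> C * (norm (x - xs))\<^sup>2"
    using f_linearization[of xs x] assms \<rho> eq0 by simp
  also have "\<dots> \<le> C * (r * norm (x - xs))"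
    unfolding power2_eq_square using C assms by (intro mult_left_mono mult_right_mono) auto
  finally have "norm (f x - D xs (x - xs)) / s0 \<le> C * r / s0 * norm (x - xs)"
    using s0 by (simp add: field_simps)
  then show "\<bar>q1 \<bullet> f x - l1 * (q1 \<bullet> (x - xs))\<bar> \<le> C * r / s0 * norm (x - xs)"
    "\<bar>q2 \<bullet> f x - l2 * (q2 \<bullet> (x - xs))\<bar> \<le> C * r / s0 * norm (x - xs)"
    using dual_le_norm[of "f x - D xs (x - xs)"] by (auto simp: inner_diff_right dual_derivative)
qed

lemma dual_f_estimate_sum:
  assumes "x \<in> cball xs \<rho>" "norm (x - xs) \<le> r"
  shows "\<bar>q1 \<bullet> f x - l1 * (q1 \<bullet> (x - xs))\<bar> \<le> C * r / s0 * (\<bar>q1 \<bullet> (x - xs)\<bar> + \<bar>q2 \<bullet> (x - xs)\<bar>)"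
    and "\<bar>q2 \<bullet> f x - l2 * (q2 \<bullet> (x - xs))\<bar> \<le> C * r / s0 * (\<bar>q1 \<bullet> (x - xs)\<bar> + \<bar>q2 \<bullet> (x - xs)\<bar>)"
proof -
  have "0 \<le> C * r / s0" using assms(2) C s0 norm_ge_zero[of "x - xs"]
    by (auto intro!: mult_nonneg_nonneg divide_nonneg_nonneg simp del: norm_ge_zero)
  then have "C * r / s0 * norm (x - xs) \<le> C * r / s0 * (\<bar>q1 \<bullet> (x - xs)\<bar> + \<bar>q2 \<bullet> (x - xs)\<bar>)"
    using norm_le_dual_sum by (rule mult_left_mono[rotated])
  then show "\<bar>q1 \<bullet> f x - l1 * (q1 \<bullet> (x - xs))\<bar> \<le> C * r / s0 * (\<bar>q1 \<bullet> (x - xs)\<bar> + \<bar>q2 \<bullet> (x - xs)\<bar>)"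
    "\<bar>q2 \<bullet> f x - l2 * (q2 \<bullet> (x - xs))\<bar> \<le> C * r / s0 * (\<bar>q1 \<bullet> (x - xs)\<bar> + \<bar>q2 \<bullet> (x - xs)\<bar>)"
    using dual_f_estimate[OF assms] by linarith+
qed

section \<open>Orbits confined to a small ball\<close>

lemma forward_orbit_cone:
  assumes x: "solution_on f (cball xs r) x0 {0..} x"
    and r: "0 < r" "r \<le> \<rho>" "4 * (C * r / s0) \<le> m * k" and k: "0 < k" "k \<le> 1" and "0 \<le> t"
  shows "\<bar>q1 \<bullet> (x t - xs)\<bar> \<le> k * \<bar>q2 \<bullet> (x t - xs)\<bar>"
proof -
  have dx: "(x has_vector_derivative f (x s)) (at s within {0..})" "norm (x s - xs) \<le> r" "x s \<in> cball xs \<rho>"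
    if "0 \<le> s" for s
    using x that \<open>r \<le> \<rho>\<close> by (force simp: solution_on_def dist_norm norm_minus_commute)+
  have dq: "((\<lambda>s. q \<bullet> (x (t + s) - xs)) has_real_derivative q \<bullet> f (x (t + s))) (at s within {0..})"
    if "0 \<le> s" for s q
  proof -
    have "((x \<circ> (\<lambda>s. t + s)) has_vector_derivative 1 *\<^sub>R f (x (t + s))) (at s within {0..})"
      by (rule vector_diff_chain_within)
         (use dx(1)[of "t + s"] that \<open>0 \<le> t\<close> in
          \<open>auto intro!: derivative_eq_intros has_vector_derivative_within_subset[of x _ "t + s" "{0..}"]\<close>)
    then show ?thesis
      unfolding has_real_derivative_iff_has_vector_derivative o_def
      by (auto intro!: derivative_eq_intros bounded_linear.has_vector_derivative[OF bounded_linear_inner_right]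
          simp: inner_diff_right)
  qed
  \<comment> \<open>The orbit shifted by \<open>t\<close> is confined to the same ball, so the cone
    estimate, which speaks about time 0, applies at every time.\<close>
  have "\<bar>q1 \<bullet> (x (t + 0) - xs)\<bar> \<le> k * \<bar>q2 \<bullet> (x (t + 0) - xs)\<bar>"
  proof (rule saddle_cone_estimate[where u' = "\<lambda>s. q1 \<bullet> f (x (t + s))" and v' = "\<lambda>s. q2 \<bullet> f (x (t + s))"
        and a = l1 and b = l2 and c = "C * r / s0" and m = m and B = "r / s0"])
    show "\<bar>q1 \<bullet> (x (t + s) - xs)\<bar> \<le> r / s0" if "0 \<le> s" for s
      using dual_le_norm(1)[of "x (t + s) - xs"] dx(2)[of "t + s"] that \<open>0 \<le> t\<close> s0
      by (meson add_nonneg_nonneg divide_right_mono less_imp_le order_trans)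
  qed (use dq dual_f_estimate_sum dx m r k C s0 \<open>0 \<le> t\<close> in auto)
  then show ?thesis by simp
qed

text \<open>Time reversal exchanges the roles of the two eigendirections.\<close>

lemma backward_orbit_cone:
  assumes x: "solution_on f (cball xs r) x0 {..0} x"
    and r: "0 < r" "r \<le> \<rho>" "4 * (C * r / s0) \<le> m"
  shows "\<bar>q2 \<bullet> (x0 - xs)\<bar> \<le> \<bar>q1 \<bullet> (x0 - xs)\<bar>"
proof -
  have dx: "(x has_vector_derivative f (x s)) (at s within {..0})" "norm (x s - xs) \<le> r" "x s \<in> cball xs \<rho>"
    if "s \<le> 0" for s
    using x that \<open>r \<le> \<rho>\<close> by (force simp: solution_on_def dist_norm norm_minus_commute)+
  have dq: "((\<lambda>s. q \<bullet> (x (- s) - xs)) has_real_derivative - (q \<bullet> f (x (- s)))) (at s within {0..})"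
    if "0 \<le> s" for s q
  proof -
    have "((x \<circ> uminus) has_vector_derivative (- 1) *\<^sub>R f (x (- s))) (at s within {0..})"
      by (rule vector_diff_chain_within)
         (use dx(1)[of "- s"] that in
          \<open>auto intro!: derivative_eq_intros has_vector_derivative_within_subset[of x _ "- s" "{..0}"]\<close>)
    then show ?thesis
      unfolding has_real_derivative_iff_has_vector_derivative o_def
      by (auto intro!: derivative_eq_intros bounded_linear.has_vector_derivative[OF bounded_linear_inner_right]
          simp: inner_diff_right)
  qed
  have "\<bar>q2 \<bullet> (x (- 0) - xs)\<bar> \<le> 1 * \<bar>q1 \<bullet> (x (- 0) - xs)\<bar>"
  proof (rule saddle_cone_estimate[where u' = "\<lambda>s. - (q2 \<bullet> f (x (- s)))" and v' = "\<lambda>s. - (q1 \<bullet> f (x (- s)))"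
        and a = "- l2" and b = "- l1" and c = "C * r / s0" and m = m and B = "r / s0"])
    fix s :: real assume s: "0 \<le> s"
    show "\<bar>q2 \<bullet> (x (- s) - xs)\<bar> \<le> r / s0"
      using dual_le_norm(2)[of "x (- s) - xs"] dx(2)[of "- s"] s s0
      by (meson divide_right_mono less_imp_le order_trans neg_le_0_iff_le)
    show "\<bar>- (q2 \<bullet> f (x (- s))) - - l2 * (q2 \<bullet> (x (- s) - xs))\<bar>
        \<le> C * r / s0 * (\<bar>q2 \<bullet> (x (- s) - xs)\<bar> + \<bar>q1 \<bullet> (x (- s) - xs)\<bar>)"
      "\<bar>- (q1 \<bullet> f (x (- s))) - - l1 * (q1 \<bullet> (x (- s) - xs))\<bar>
        \<le> C * r / s0 * (\<bar>q2 \<bullet> (x (- s) - xs)\<bar> + \<bar>q1 \<bullet> (x (- s) - xs)\<bar>)"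
      using dual_f_estimate_sum[OF dx(3,2), of "- s"] s by (auto simp: abs_minus_commute add.commute)
  qed (use dq m r C s0 in auto)
  then show ?thesis using x by (simp add: solution_on_def)
qed

text \<open>In the cone of opening 1 the error in the equation for \<open>v\<close> is at most
  \<open>m / 2 * \<bar>v\<bar>\<close>, so contraction wins and \<open>\<bar>v\<bar>\<close> does
  not grow; there \<open>\<bar>v\<bar>\<close> also controls the norm. The resulting bound is
  proportional to the initial distance instead of to \<open>r\<close>.\<close>

lemma forward_orbit_small:
  assumes x: "solution_on f (cball xs r) x0 {0..} x"
    and r: "0 < r" "r \<le> \<rho>" "4 * (C * r / s0) \<le> m" and "0 \<le> t"
  shows "norm (x t - xs) \<le> 2 / s0 * norm (x0 - xs)"
proof -
  have cone: "\<bar>q1 \<bullet> (x s - xs)\<bar> \<le> \<bar>q2 \<bullet> (x s - xs)\<bar>" if "0 \<le> s" for s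
    using forward_orbit_cone[OF x, of 1 s] r that by simp
  have dx: "(x has_vector_derivative f (x s)) (at s within {0..})" "norm (x s - xs) \<le> r" "x s \<in> cball xs \<rho>"
    if "0 \<le> s" for s
    using x that \<open>r \<le> \<rho>\<close> by (force simp: solution_on_def dist_norm norm_minus_commute)+
  define v where "v s = q2 \<bullet> (x s - xs)" for s
  have "(v t)\<^sup>2 \<le> ((v 0)\<^sup>2 + 0 * t) * exp (0 * t)"
  proof (rule gronwall_real[where T = t and N' = "\<lambda>s. 2 * v s * (q2 \<bullet> f (x s))"])
    fix s assume "s \<in> {0..t}"
    then have s: "0 \<le> s" by simp
    have "(x has_vector_derivative f (x s)) (at s within {0..t})"
      using dx(1)[OF s] by (rule has_vector_derivative_within_subset) auto
    then have "(v has_real_derivative q2 \<bullet> f (x s)) (at s within {0..t})"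
      unfolding has_real_derivative_iff_has_vector_derivative v_def inner_diff_right
      by (auto intro!: derivative_eq_intros bounded_linear.has_vector_derivative[OF bounded_linear_inner_right])
    then show "((\<lambda>s. (v s)\<^sup>2) has_real_derivative 2 * v s * (q2 \<bullet> f (x s))) (at s within {0..t})"
      by (auto intro!: derivative_eq_intros)
    have "v s * (q2 \<bullet> f (x s) - l2 * v s) \<le> \<bar>v s\<bar> * \<bar>q2 \<bullet> f (x s) - l2 * v s\<bar>"
      by (metis abs_ge_self abs_mult)
    also have "\<dots> \<le> \<bar>v s\<bar> * (m / 4 * (\<bar>v s\<bar> + \<bar>v s\<bar>))"
    proof (intro mult_left_mono)
      have "\<bar>q2 \<bullet> f (x s) - l2 * v s\<bar> \<le> C * r / s0 * (\<bar>q1 \<bullet> (x s - xs)\<bar> + \<bar>v s\<bar>)"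
        using dual_f_estimate_sum(2)[OF dx(3)[OF s] dx(2)[OF s]] by (simp add: v_def)
      also have "\<dots> \<le> m / 4 * (\<bar>v s\<bar> + \<bar>v s\<bar>)"
      proof (rule mult_mono)
        show "C * r / s0 \<le> m / 4" using r(3) by linarith
      qed (use cone[OF s] m in \<open>auto simp: v_def\<close>)
      finally show "\<bar>q2 \<bullet> f (x s) - l2 * v s\<bar> \<le> m / 4 * (\<bar>v s\<bar> + \<bar>v s\<bar>)" .
    qed auto
    also have "\<dots> = m / 2 * (v s)\<^sup>2" by (simp add: power2_eq_square)
    finally have "v s * (q2 \<bullet> f (x s)) \<le> (l2 + m / 2) * (v s)\<^sup>2"
      by (simp add: power2_eq_square algebra_simps)
    also have "\<dots> \<le> 0" using m by (intro mult_nonpos_nonneg) auto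
    finally show "2 * v s * (q2 \<bullet> f (x s)) \<le> 0 * (v s)\<^sup>2 + 0" by simp
  qed (use \<open>0 \<le> t\<close> in auto)
  then have "\<bar>v t\<bar> \<le> \<bar>v 0\<bar>" by (simp add: abs_le_square_iff)
  also have "\<bar>v 0\<bar> \<le> norm (x0 - xs) / s0" using dual_le_norm(2) x by (simp add: v_def solution_on_def)
  finally show ?thesis
    using norm_le_dual_sum[of "x t - xs"] cone[OF \<open>0 \<le> t\<close>] by (simp add: v_def)
qed

text \<open>The radius \<open>r\<close> guarantees opening 1 and hence confinement to radius
  \<open>2 / s0 * \<delta>\<close>. A second application of the cone estimate at that radius gives
  opening \<open>k\<close>, however small, once \<open>\<delta>\<close> is small in terms of
  \<open>k\<close>.\<close>

lemma stable_manifold_cone: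
  assumes x0: "x0 \<in> stable_manifold f (ball xs r) xs"
    and r: "0 < r" "r \<le> \<rho>" "4 * (C * r / s0) \<le> m"
    and k: "0 < k" "k \<le> 1"
    and \<delta>: "norm (x0 - xs) \<le> \<delta>" "0 < \<delta>" "2 / s0 * \<delta> \<le> \<rho>" "4 * (C * (2 / s0 * \<delta>) / s0) \<le> m * k"
  shows "\<bar>q1 \<bullet> (x0 - xs)\<bar> \<le> k * \<bar>q2 \<bullet> (x0 - xs)\<bar>"
proof -
  from x0 obtain x where x: "solution_on f (ball xs r) x0 {0..} x"
    by (auto simp: stable_manifold_def)
  then have x': "solution_on f (cball xs r) x0 {0..} x"
    by (force simp: solution_on_def)
  have "norm (x t - xs) \<le> 2 / s0 * \<delta>" if "0 \<le> t" for t
  proof -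
    have "norm (x t - xs) \<le> 2 / s0 * norm (x0 - xs)" by (rule forward_orbit_small[OF x' r that])
    also have "\<dots> \<le> 2 / s0 * \<delta>" using \<delta> s0 by (intro mult_left_mono) auto
    finally show ?thesis .
  qed
  then have "solution_on f (cball xs (2 / s0 * \<delta>)) x0 {0..} x"
    using x' by (auto simp: solution_on_def dist_norm norm_minus_commute)
  from forward_orbit_cone[OF this _ _ _ k, of 0] show ?thesis
    using \<delta> s0 x by (simp add: solution_on_def)
qed

lemma unstable_manifold_cone:
  assumes x0: "x0 \<in> unstable_manifold f (ball xs r) xs"
    and r: "0 < r" "r \<le> \<rho>" "4 * (C * r / s0) \<le> m"
  shows "\<bar>q2 \<bullet> (x0 - xs)\<bar> \<le> \<bar>q1 \<bullet> (x0 - xs)\<bar>"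
proof -
  from x0 obtain x where "solution_on f (ball xs r) x0 {..0} x"
    by (auto simp: unstable_manifold_def)
  then have "solution_on f (cball xs r) x0 {..0} x"
    by (force simp: solution_on_def)
  from backward_orbit_cone[OF this r] show ?thesis .
qed

text \<open>The flow \<open>exp (t D)\<close> of the linearization at the equilibrium, written in the eigenbasis.\<close>

definition linear_flow :: "real \<Rightarrow> real^2 \<Rightarrow> real^2" where
  "linear_flow t h = (exp (l1 * t) * (q1 \<bullet> h)) *\<^sub>R e1 + (exp (l2 * t) * (q2 \<bullet> h)) *\<^sub>R e2"

lemma dual_linear_flow: "q1 \<bullet> linear_flow t h = exp (l1 * t) * (q1 \<bullet> h)" "q2 \<bullet> linear_flow t h = exp (l2 * t) * (q2 \<bullet> h)"
  by (simp_all add: linear_flow_def inner_add_right)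

lemma flow_derivative_near_linear:
  assumes "0 \<le> T" "0 < \<eta>"
  obtains \<delta> where "0 < \<delta>" "\<delta> \<le> \<rho>"
    "\<And>x. x \<in> ball xs \<delta> \<Longrightarrow> x \<in> X0 f U T \<and> (\<exists>M. (flow f U T has_derivative M) (at x) \<and>
       (\<forall>h. norm (M h - linear_flow T h) \<le> \<eta> * norm h))"
proof -
  define G where "G = exp ((L + 1) * T)"
  have G: "1 \<le> G" using L \<open>0 \<le> T\<close> by (simp add: G_def)
  \<comment> \<open>The derivative estimate has error \<open>C * r * G\<^sup>2\<close>, which this
    makes at most \<open>\<eta>\<close>; the \<open>+ 1\<close> allows \<open>C = 0\<close>.
    Starting points within \<open>r / G\<close> have orbits staying within \<open>r\<close> up to
    time \<open>T\<close>.\<close>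
  define r where "r = min \<rho> (\<eta> / (C * G\<^sup>2 + 1))"
  have pos: "0 < C * G\<^sup>2 + 1" using C by (simp add: add_nonneg_pos)
  have r: "0 < r" "r \<le> \<rho>" using \<rho> \<open>0 < \<eta>\<close> pos by (auto simp: r_def)
  have "C * r * G\<^sup>2 \<le> (C * G\<^sup>2 + 1) * r" using r by (simp add: algebra_simps)
  also have "\<dots> \<le> (C * G\<^sup>2 + 1) * (\<eta> / (C * G\<^sup>2 + 1))"
    using pos by (intro mult_left_mono) (auto simp: r_def)
  also have "\<dots> = \<eta>" using pos by simp
  finally have \<eta>: "C * r * G\<^sup>2 \<le> \<eta>" .
  show ?thesis
  proof (rule that[of "r / G"])
    show "0 < r / G" using r G by simp
    have "r / G \<le> r" using r G by (simp add: field_simps)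
    then show "r / G \<le> \<rho>" using r by simp
    fix x assume "x \<in> ball xs (r / G)"
    then have x: "norm (x - xs) * exp ((L + 1) * T) < r"
      using G unfolding G_def[symmetric] by (simp add: dist_norm norm_minus_commute field_simps)
    from flow_has_derivative[OF \<open>0 \<le> T\<close> r x] obtain M :: "(real^2) \<Rightarrow>\<^sub>L (real^2)"
      where M: "(flow f U T has_derivative M) (at x)"
        and Mw: "\<And>h w. w 0 = h \<Longrightarrow> (\<And>t. t \<in> {0..T} \<Longrightarrow> (w has_vector_derivative D xs (w t)) (at t within {0..T})) \<Longrightarrow>
          norm (M h - w T) \<le> C * r * G\<^sup>2 * norm h" unfolding G_def by blast
    have "norm (M h - linear_flow T h) \<le> \<eta> * norm h" for h
    proof -
      have "norm (M h - linear_flow T h) \<le> C * r * G\<^sup>2 * norm h"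
      proof (rule Mw)
        show "linear_flow 0 h = h" using eigen_decomposition[of h] by (simp add: linear_flow_def)
        show "((\<lambda>t. linear_flow t h) has_vector_derivative D xs (linear_flow t h)) (at t within {0..T})" for t
          unfolding linear_flow_def
          by (auto intro!: derivative_eq_intros simp: blinfun.bilinear_simps e1 e2 algebra_simps)
      qed
      also have "\<dots> \<le> \<eta> * norm h" using \<eta> by (intro mult_right_mono) auto
      finally show ?thesis .
    qed
    with M show "x \<in> X0 f U T \<and> (\<exists>M. (flow f U T has_derivative M) (at x) \<and>
       (\<forall>h. norm (M h - linear_flow T h) \<le> \<eta> * norm h))"
      using mem_X0[OF \<open>0 \<le> T\<close> r x] by blast
  qed
qed

end

section \<open>Area of the dynamical balls\<close>

lemma measure_cball_2: "0 \<le> r \<Longrightarrow> measure lebesgue (cball (x :: real^2) r) = pi * r\<^sup>2"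
  by (simp add: content_cball unit_ball_vol_2)

lemma ftme_ball_subset_cball: "ftme_ball f U T \<alpha> x r \<subseteq> cball x r"
  by (auto simp: ftme_ball_def dist_norm norm_minus_commute)

lemma measure_ftme_ratio_le_1:
  assumes "0 < r"
  shows "measure lebesgue (ftme_ball f U T \<alpha> x r) / measure lebesgue (cball x r) \<le> 1"
proof -
  have "measure lebesgue (ftme_ball f U T \<alpha> x r) \<le> measure lebesgue (cball x r)"
  proof (cases "ftme_ball f U T \<alpha> x r \<in> sets lebesgue")
    case True
    then show ?thesis
      by (rule measure_mono_fmeasurable[OF ftme_ball_subset_cball]) simp
  qed (simp add: measure_notin_sets)
  then show ?thesis using assms unfolding measure_cball_2[OF less_imp_le[OF assms]]
    by (simp add: divide_le_eq)
qed

lemma ftme_nonneg: "0 < T \<Longrightarrow> 0 \<le> ftme f U T \<alpha> x"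
  unfolding ftme_def
proof (intro le_Limsup)
  assume "0 < T"
  have "\<forall>\<^sub>F r in at_right (0::real). 0 < r" by (rule eventually_at_right_less)
  then show "\<forall>\<^sub>F r in at_right 0. 0 \<le> ereal (- (1 / T) *
      ln (measure lebesgue (ftme_ball f U T \<alpha> x r) / measure lebesgue (cball x r)))"
  proof eventually_elim
    case (elim r)
    let ?q = "measure lebesgue (ftme_ball f U T \<alpha> x r) / measure lebesgue (cball x r)"
    \<comment> \<open>At ratio 0 the convention \<open>ln 0 = 0\<close> gives a term equal to 0,
      consistent with the bound.\<close>
    have "ln q \<le> 0" if "0 \<le> q" "q \<le> 1" for q :: real
      using that by (cases "q = 0") auto
    then have "ln ?q \<le> 0" using measure_ftme_ratio_le_1[OF elim] by simp
    then have "0 \<le> - (1 / T) * ln ?q" using \<open>0 < T\<close> by (intro mult_nonpos_nonpos) auto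
    then show ?case by (simp only: ereal_less_eq zero_ereal_def)
  qed
qed simp

lemma ftme_upperI:
  assumes "0 < T" "0 < q"
    and "\<forall>\<^sub>F r in at_right 0. q * (pi * r\<^sup>2) \<le> measure lebesgue (ftme_ball f U T \<alpha> x r)"
  shows "ftme f U T \<alpha> x \<le> ereal (- (1 / T) * ln q)"
  unfolding ftme_def
proof (intro Limsup_bounded)
  have "\<forall>\<^sub>F r in at_right (0::real). 0 < r" by (rule eventually_at_right_less)
  with assms(3) show "\<forall>\<^sub>F r in at_right 0. ereal (- (1 / T) *
      ln (measure lebesgue (ftme_ball f U T \<alpha> x r) / measure lebesgue (cball x r))) \<le> ereal (- (1 / T) * ln q)"
  proof eventually_elim
    case (elim r)
    then have "q \<le> measure lebesgue (ftme_ball f U T \<alpha> x r) / measure lebesgue (cball x r)"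
      unfolding measure_cball_2[OF less_imp_le[OF elim(2)]] by (simp add: le_divide_eq)
    then have "ln q \<le> ln (measure lebesgue (ftme_ball f U T \<alpha> x r) / measure lebesgue (cball x r))"
      using \<open>0 < q\<close> by (intro ln_mono) auto
    then show ?case using \<open>0 < T\<close> unfolding ereal_less_eq
      by (intro mult_left_mono_neg) auto
  qed
qed

text \<open>The bound with \<open>p\<close> keeps the ratio positive. At ratio 0 the convention
  \<open>ln 0 = 0\<close> would spoil the monotonicity of the logarithm.\<close>

lemma ftme_lowerI:
  assumes "0 < T" "0 < p"
    and "\<forall>\<^sub>F r in at_right 0. p * (pi * r\<^sup>2) \<le> measure lebesgue (ftme_ball f U T \<alpha> x r)"
    and "\<forall>\<^sub>F r in at_right 0. measure lebesgue (ftme_ball f U T \<alpha> x r) \<le> q * (pi * r\<^sup>2)"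
  shows "ereal (- (1 / T) * ln q) \<le> ftme f U T \<alpha> x"
  unfolding ftme_def
proof (intro le_Limsup)
  have "\<forall>\<^sub>F r in at_right (0::real). 0 < r" by (rule eventually_at_right_less)
  with assms(3,4) show "\<forall>\<^sub>F r in at_right 0. ereal (- (1 / T) * ln q) \<le> ereal (- (1 / T) *
      ln (measure lebesgue (ftme_ball f U T \<alpha> x r) / measure lebesgue (cball x r)))"
  proof eventually_elim
    case (elim r)
    then have "p \<le> measure lebesgue (ftme_ball f U T \<alpha> x r) / measure lebesgue (cball x r)"
      "measure lebesgue (ftme_ball f U T \<alpha> x r) / measure lebesgue (cball x r) \<le> q"
      unfolding measure_cball_2[OF less_imp_le[OF elim(3)]] by (simp_all add: le_divide_eq divide_le_eq)
    then have "ln (measure lebesgue (ftme_ball f U T \<alpha> x r) / measure lebesgue (cball x r)) \<le> ln q"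
      using \<open>0 < p\<close> by (intro ln_mono) auto
    then show ?case using \<open>0 < T\<close> unfolding ereal_less_eq
      by (intro mult_left_mono_neg) auto
  qed
qed simp

lemma exp_stretching_rate:
  assumes "0 < T" "(flow f U T has_derivative M) (at x)" "v \<noteq> 0" "M v \<noteq> 0"
  shows "exp (stretching_rate f U x T v * T) = norm (M v) / norm v"
  using assms frechet_derivative_at[OF assms(2)] by (simp add: stretching_rate_def)

context C2_saddle
begin

section \<open>Inner and outer parallelograms for dynamical balls\<close>

definition parallelogram :: "real^2 \<Rightarrow> real \<Rightarrow> real \<Rightarrow> (real^2) set" where
  "parallelogram x a b = {y. \<bar>q1 \<bullet> (y - x)\<bar> \<le> a \<and> \<bar>q2 \<bullet> (y - x)\<bar> \<le> b}"

text \<open>The area scaling from eigencoordinates to the plane. Its being positive and independent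
  of \<open>T\<close> is what matters: it contributes a term of order \<open>1 / T\<close>.\<close>

definition \<Delta> :: real where
  "\<Delta> = \<bar>det (matrix (\<lambda>z :: real^2. z $ 1 *\<^sub>R e1 + z $ 2 *\<^sub>R e2))\<bar>"

lemma parallelogram_measure:
  assumes "0 \<le> a" "0 \<le> b"
  shows "parallelogram x a b \<in> lmeasurable" "measure lebesgue (parallelogram x a b) = 4 * \<Delta> * a * b"
proof -
  define g where "g z = z $ 1 *\<^sub>R e1 + z $ 2 *\<^sub>R e2" for z :: "real^2"
  have lin: "linear g"
    by (rule linearI) (simp_all add: g_def algebra_simps)
  define c where "c = (vector [a, b] :: real^2)"
  have cbox: "cbox (- c) c = {z. \<bar>z $ 1\<bar> \<le> a \<and> \<bar>z $ 2\<bar> \<le> b}"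
    by (auto simp: c_def mem_box_cart forall_2 abs_le_iff)
  have "parallelogram x a b = (+) x ` g ` cbox (- c) c"
  proof (intro equalityI subsetI)
    fix y assume y: "y \<in> parallelogram x a b"
    let ?z = "vector [q1 \<bullet> (y - x), q2 \<bullet> (y - x)] :: real^2"
    have "y = x + g ?z" using eigen_decomposition[of "y - x"] by (simp add: g_def)
    moreover have "?z \<in> cbox (- c) c" using y by (simp add: cbox parallelogram_def)
    ultimately show "y \<in> (+) x ` g ` cbox (- c) c" by blast
  qed (auto simp: parallelogram_def g_def cbox inner_add_right)
  moreover have "measure lebesgue (cbox (- c) c) = 4 * a * b"
  proof -
    have "cbox (- c) c \<noteq> {}" using assms by (auto simp: cbox intro!: exI[of _ 0])
    then show ?thesis by (simp add: content_cbox_cart UNIV_2 c_def)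
  qed
  ultimately show "parallelogram x a b \<in> lmeasurable"
    "measure lebesgue (parallelogram x a b) = 4 * \<Delta> * a * b"
    using measurable_linear_image[OF lin, of "cbox (- c) c"] measure_linear_image[OF lin, of "cbox (- c) c"]
    by (simp_all add: measurable_translation measure_translation \<Delta>_def g_def[abs_def])
qed

lemma \<Delta>_pos: "0 < \<Delta>"
proof -
  let ?g = "\<lambda>z :: real^2. z $ 1 *\<^sub>R e1 + z $ 2 *\<^sub>R e2"
  have lin: "linear ?g" by (rule linearI) (simp_all add: algebra_simps)
  have "inj ?g"
    unfolding linear_injective_0[OF lin]
  proof (intro allI impI)
    fix z :: "real^2" assume "?g z = 0"
    then have "z $ 1 = 0 \<and> z $ 2 = 0" by (rule eigenvectors_independent)
    then show "z = 0" by (simp add: vec_eq_iff forall_2)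
  qed
  then show ?thesis using det_nz_iff_inj[OF lin] by (simp add: \<Delta>_def)
qed

lemma norm_ge_dual: "norm z \<ge> s0 * \<bar>q1 \<bullet> z\<bar>" "norm z \<ge> s0 * \<bar>q2 \<bullet> z\<bar>"
  using dual_le_norm[of z] s0 by (simp_all add: field_simps)

lemma norm_linear_flow_le: "norm (linear_flow t h) \<le> exp (l1 * t) * \<bar>q1 \<bullet> h\<bar> + exp (l2 * t) * \<bar>q2 \<bullet> h\<bar>"
  using norm_le_dual_sum[of "linear_flow t h"] by (simp add: dual_linear_flow abs_mult)

text \<open>The error is measured against \<open>r\<close>, not \<open>norm (y - x)\<close>, as
  suits comparing sets at scale \<open>r\<close>. One \<open>\<eta>\<close> is for the
  differentiability remainder, the other for replacing the derivative by
  \<open>linear_flow T\<close>.\<close>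

definition linearized :: "real \<Rightarrow> real \<Rightarrow> (real^2) set \<Rightarrow> real^2 \<Rightarrow> real \<Rightarrow> bool" where
  "linearized T \<eta> S x r \<longleftrightarrow> 0 < r \<and> cball x r \<subseteq> S \<and>
     (\<forall>y\<in>cball x r. norm (flow f U T y - flow f U T x - linear_flow T (y - x)) \<le> 2 * \<eta> * r)"

lemma eventually_linearized:
  assumes "open S" "x \<in> S" "0 < \<eta>"
    and M: "(flow f U T has_derivative M) (at x)" "\<And>h. norm (M h - linear_flow T h) \<le> \<eta> * norm h"
  shows "\<forall>\<^sub>F r in at_right 0. linearized T \<eta> S x r"
proof -
  from M(1) obtain d where d: "0 < d"
    "\<And>y. norm (y - x) < d \<Longrightarrow> norm (flow f U T y - flow f U T x - M (y - x)) \<le> \<eta> * norm (y - x)"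
    using \<open>0 < \<eta>\<close> unfolding has_derivative_at_alt by blast
  from assms obtain d' where d': "0 < d'" "cball x d' \<subseteq> S"
    using open_contains_cball by blast
  have "\<forall>\<^sub>F r in at_right 0. r < min d d'"
    using eventually_at_right_real[of 0 "min d d'"] d d' by (auto elim: eventually_mono)
  moreover have "\<forall>\<^sub>F r in at_right (0::real). 0 < r" by (rule eventually_at_right_less)
  ultimately show ?thesis
  proof eventually_elim
    case (elim r)
    have "norm (flow f U T y - flow f U T x - linear_flow T (y - x)) \<le> 2 * \<eta> * r" if "y \<in> cball x r" for y
    proof -
      have y: "norm (y - x) \<le> r" using that by (simp add: dist_norm norm_minus_commute)
      have "norm (flow f U T y - flow f U T x - linear_flow T (y - x)) \<le>
          norm (flow f U T y - flow f U T x - M (y - x)) + norm (M (y - x) - linear_flow T (y - x))"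
        by norm
      also have "\<dots> \<le> \<eta> * norm (y - x) + \<eta> * norm (y - x)"
        using y elim by (intro add_mono d M(2)) auto
      also have "\<dots> \<le> 2 * \<eta> * r" using y \<open>0 < \<eta>\<close> by simp
      finally show ?thesis .
    qed
    then show ?case using elim d' by (force simp: linearized_def)
  qed
qed

text \<open>Continuity on \<open>S\<close> makes the set closed. Measurability is what allows its
  area to be bounded from below by that of a subset.\<close>

lemma ftme_ball_lmeasurable:
  assumes "S \<subseteq> X0 f U T" "continuous_on S (flow f U T)" "linearized T \<eta> S x r"
  shows "ftme_ball f U T \<alpha> x r \<in> lmeasurable"
proof -
  have sub: "cball x r \<subseteq> S" using assms by (simp add: linearized_def)
  have "ftme_ball f U T \<alpha> x r =
      cball x r \<inter> (\<lambda>y. norm (flow f U T y - flow f U T x)) -` {.. r * exp (\<alpha> * T)}"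
    using sub assms(1) by (auto simp: ftme_ball_def dist_norm norm_minus_commute)
  also have "closed \<dots>"
    by (intro continuous_closed_preimage continuous_intros continuous_on_subset[OF assms(2) sub]) auto
  finally have "closed (ftme_ball f U T \<alpha> x r)" .
  moreover have "bounded (ftme_ball f U T \<alpha> x r)"
    by (rule bounded_subset[OF bounded_cball ftme_ball_subset_cball])
  ultimately show ?thesis by (intro lmeasurable_compact) (simp add: compact_eq_bounded_closed)
qed

lemma ftme_ball_measure_ge:
  assumes S: "S \<subseteq> X0 f U T" "continuous_on S (flow f U T)" and r: "linearized T \<eta> S x r"
    and "0 \<le> T" "0 < c" "c \<le> 1" "l2 \<le> \<gamma>" "\<gamma> \<le> l1"
    and \<alpha>: "c * exp (\<gamma> * T) \<le> exp (\<alpha> * T)" and \<eta>: "4 * \<eta> \<le> c * exp (\<gamma> * T)"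
  shows "\<Delta> * c\<^sup>2 / (4 * pi) * exp ((\<gamma> - l1) * T) * (pi * r\<^sup>2) \<le> measure lebesgue (ftme_ball f U T \<alpha> x r)"
proof -
  have "0 < r" using r by (simp add: linearized_def)
  \<comment> \<open>Both eigendirections are stretched to at most
    \<open>exp (\<gamma> * T) * b\<close>, since \<open>exp (l1 * T) * a\<close> equals this and
    \<open>l2 \<le> \<gamma>\<close>. The quarters make the sum half of
    \<open>c * exp (\<gamma> * T) * r\<close>; the other half is left for the linearization
    error.\<close>
  define a b where "a = c / 4 * exp ((\<gamma> - l1) * T) * r" and "b = c / 4 * r"
  have ab: "0 \<le> a" "0 \<le> b" using \<open>0 < r\<close> \<open>0 < c\<close> by (auto simp: a_def b_def)
  have "a \<le> b" unfolding a_def b_def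
    using \<open>0 < r\<close> \<open>0 < c\<close> \<open>0 \<le> T\<close> \<open>\<gamma> \<le> l1\<close> by (simp add: mult_nonpos_nonneg)
  have "parallelogram x a b \<subseteq> ftme_ball f U T \<alpha> x r"
  proof
    fix y assume "y \<in> parallelogram x a b"
    then have y: "\<bar>q1 \<bullet> (y - x)\<bar> \<le> a" "\<bar>q2 \<bullet> (y - x)\<bar> \<le> b" by (auto simp: parallelogram_def)
    have "norm (y - x) \<le> b + b" using norm_le_dual_sum[of "y - x"] y \<open>a \<le> b\<close> by linarith
    also have "b + b = c / 2 * r" by (simp add: b_def)
    also have "\<dots> \<le> 1 * r" using \<open>c \<le> 1\<close> \<open>0 < r\<close> by (intro mult_right_mono) auto
    finally have yr: "norm (y - x) \<le> r" by simp
    then have y_in: "y \<in> cball x r" by (simp add: dist_norm norm_minus_commute)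
    have "norm (linear_flow T (y - x)) \<le> exp (l1 * T) * \<bar>q1 \<bullet> (y - x)\<bar> + exp (l2 * T) * \<bar>q2 \<bullet> (y - x)\<bar>"
      by (rule norm_linear_flow_le)
    also have "\<dots> \<le> exp (l1 * T) * a + exp (\<gamma> * T) * b"
      using y \<open>l2 \<le> \<gamma>\<close> \<open>0 \<le> T\<close> by (intro add_mono mult_mono) (auto intro: mult_right_mono)
    also have "exp (l1 * T) * a = exp (\<gamma> * T) * b"
      by (simp add: a_def b_def left_diff_distrib exp_diff)
    finally have "norm (linear_flow T (y - x)) \<le> c * exp (\<gamma> * T) / 2 * r" by (simp add: b_def mult_ac)
    moreover have "norm (flow f U T y - flow f U T x) \<le>
        norm (flow f U T y - flow f U T x - linear_flow T (y - x)) + norm (linear_flow T (y - x))" by norm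
    moreover have "norm (flow f U T y - flow f U T x - linear_flow T (y - x)) \<le> 2 * \<eta> * r"
      using r y_in by (simp add: linearized_def)
    moreover have "2 * \<eta> * r \<le> c * exp (\<gamma> * T) / 2 * r" using \<eta> \<open>0 < r\<close> by (intro mult_right_mono) auto
    ultimately have "norm (flow f U T y - flow f U T x) \<le> c * exp (\<gamma> * T) * r" by (simp add: field_simps)
    also have "\<dots> \<le> r * exp (\<alpha> * T)" using \<alpha> \<open>0 < r\<close> by (simp add: mult.commute)
    finally show "y \<in> ftme_ball f U T \<alpha> x r"
      using yr y_in r S(1) by (auto simp: ftme_ball_def linearized_def)
  qed
  then have "measure lebesgue (parallelogram x a b) \<le> measure lebesgue (ftme_ball f U T \<alpha> x r)"
    using parallelogram_measure(1)[OF ab] ftme_ball_lmeasurable[OF S r]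
    by (intro measure_mono_fmeasurable) (auto dest: fmeasurableD)
  then show ?thesis unfolding parallelogram_measure(2)[OF ab]
    by (simp add: a_def b_def power2_eq_square field_simps)
qed

lemma ftme_ball_measure_le:
  assumes r: "linearized T \<eta> S x r" and "0 \<le> \<eta>" and c: "exp (\<alpha> * T) + 2 * \<eta> \<le> c * exp (l2 * T)"
  shows "measure lebesgue (ftme_ball f U T \<alpha> x r) \<le> 4 * \<Delta> * c / (pi * s0\<^sup>2) * exp ((l2 - l1) * T) * (pi * r\<^sup>2)"
proof -
  have "0 < r" using r by (simp add: linearized_def)
  \<comment> \<open>The image condition bounds the expanding coordinate, which was multiplied by
    \<open>exp (l1 * T)\<close>; the condition \<open>norm (y - x) \<le> r\<close> bounds the
    contracting one.\<close>
  define a b where "a = c / s0 * exp ((l2 - l1) * T) * r" and "b = r / s0"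
  have "0 < c * exp (l2 * T)" using c \<open>0 \<le> \<eta>\<close> by (smt (verit) exp_gt_zero)
  then have "0 < c" by (simp add: zero_less_mult_iff)
  then have ab: "0 \<le> a" "0 \<le> b" using \<open>0 < r\<close> s0 by (auto simp: a_def b_def)
  have "ftme_ball f U T \<alpha> x r \<subseteq> parallelogram x a b"
  proof
    fix y assume "y \<in> ftme_ball f U T \<alpha> x r"
    then have y: "norm (y - x) \<le> r" "norm (flow f U T y - flow f U T x) \<le> r * exp (\<alpha> * T)"
      by (auto simp: ftme_ball_def)
    have "norm (flow f U T y - flow f U T x - linear_flow T (y - x)) \<le> 2 * \<eta> * r"
      using r y by (simp add: linearized_def dist_norm norm_minus_commute)
    moreover have "norm (linear_flow T (y - x)) \<le>
        norm (flow f U T y - flow f U T x) + norm (flow f U T y - flow f U T x - linear_flow T (y - x))" by norm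
    ultimately have "norm (linear_flow T (y - x)) \<le> (exp (\<alpha> * T) + 2 * \<eta>) * r"
      using y by (simp add: algebra_simps)
    also have "\<dots> \<le> c * exp (l2 * T) * r" using c \<open>0 < r\<close> by (intro mult_right_mono) auto
    finally have "s0 * \<bar>q1 \<bullet> linear_flow T (y - x)\<bar> \<le> c * exp (l2 * T) * r"
      using norm_ge_dual(1)[of "linear_flow T (y - x)"] by linarith
    then have "\<bar>q1 \<bullet> (y - x)\<bar> \<le> a"
      using s0 by (simp add: dual_linear_flow abs_mult a_def left_diff_distrib exp_diff field_simps)
    moreover have "\<bar>q2 \<bullet> (y - x)\<bar> \<le> b"
      using dual_le_norm(2)[of "y - x"] divide_right_mono[OF y(1), of s0] s0 by (simp add: b_def)
    ultimately show "y \<in> parallelogram x a b" by (simp add: parallelogram_def)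
  qed
  then have "measure lebesgue (ftme_ball f U T \<alpha> x r) \<le> measure lebesgue (parallelogram x a b)"
    using parallelogram_measure(1)[OF ab]
    by (cases "ftme_ball f U T \<alpha> x r \<in> sets lebesgue")
       (auto intro: measure_mono_fmeasurable simp: measure_notin_sets)
  then show ?thesis unfolding parallelogram_measure(2)[OF ab]
    using s0 by (simp add: a_def b_def power2_eq_square field_simps)
qed

section \<open>Stretching along the vector field\<close>

text \<open>Here \<open>\<gamma>\<close> is a guaranteed exponential rate of stretching along the
  field: \<open>l2\<close> near the equilibrium in general, \<open>l1 - \<epsilon> / 4\<close> on
  the unstable cone.\<close>

lemma ftme_le_of_stretching:
  assumes S: "open S" "x \<in> S" "S \<subseteq> X0 f U T" "continuous_on S (flow f U T)"
    and M: "(flow f U T has_derivative M) (at x)" "\<And>h. norm (M h - linear_flow T h) \<le> \<eta> * norm h"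
    and "0 < T" "0 < \<eta>" "0 < c" "c \<le> 1" "l2 \<le> \<gamma>" "\<gamma> \<le> l1"
    and \<alpha>: "c * exp (\<gamma> * T) \<le> exp (\<alpha> * T)" and \<eta>: "4 * \<eta> \<le> c * exp (\<gamma> * T)"
  shows "ftme f U T \<alpha> x \<le> ereal (l1 - \<gamma> - ln (\<Delta> * c\<^sup>2 / (4 * pi)) / T)"
proof -
  have pos: "0 < \<Delta> * c\<^sup>2 / (4 * pi)" using \<Delta>_pos \<open>0 < c\<close> by simp
  have "\<forall>\<^sub>F r in at_right 0. \<Delta> * c\<^sup>2 / (4 * pi) * exp ((\<gamma> - l1) * T) * (pi * r\<^sup>2)
      \<le> measure lebesgue (ftme_ball f U T \<alpha> x r)"
    using eventually_linearized[OF S(1,2) \<open>0 < \<eta>\<close> M]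
    by eventually_elim (rule ftme_ball_measure_ge[OF S(3,4)], use assms in auto)
  moreover have "0 < \<Delta> * c\<^sup>2 / (4 * pi) * exp ((\<gamma> - l1) * T)" using pos by (intro mult_pos_pos) auto
  ultimately have "ftme f U T \<alpha> x \<le> ereal (- (1 / T) * ln (\<Delta> * c\<^sup>2 / (4 * pi) * exp ((\<gamma> - l1) * T)))"
    using ftme_upperI[OF \<open>0 < T\<close>] by blast
  also have "ln (\<Delta> * c\<^sup>2 / (4 * pi) * exp ((\<gamma> - l1) * T)) = ln (\<Delta> * c\<^sup>2 / (4 * pi)) + (\<gamma> - l1) * T"
    using pos by (subst ln_mult_pos) auto
  also have "- (1 / T) * \<dots> = l1 - \<gamma> - ln (\<Delta> * c\<^sup>2 / (4 * pi)) / T"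
    using \<open>0 < T\<close> by (simp add: field_simps)
  finally show ?thesis .
qed

lemma ftme_ge_of_stretching:
  assumes S: "open S" "x \<in> S" "S \<subseteq> X0 f U T" "continuous_on S (flow f U T)"
    and M: "(flow f U T has_derivative M) (at x)" "\<And>h. norm (M h - linear_flow T h) \<le> \<eta> * norm h"
    and "0 < T" "0 < \<eta>" "0 < c" "c \<le> 1"
    and \<alpha>: "c * exp (l2 * T) \<le> exp (\<alpha> * T)" and \<eta>: "4 * \<eta> \<le> c * exp (l2 * T)"
    and "0 < c'" and c': "exp (\<alpha> * T) + 2 * \<eta> \<le> c' * exp (l2 * T)"
  shows "ereal (l1 - l2 - ln (4 * \<Delta> * c' / (pi * s0\<^sup>2)) / T) \<le> ftme f U T \<alpha> x"
proof -
  have pos: "0 < \<Delta> * c\<^sup>2 / (4 * pi) * exp ((l2 - l1) * T)" "0 < 4 * \<Delta> * c' / (pi * s0\<^sup>2)"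
    using \<Delta>_pos \<open>0 < c\<close> \<open>0 < c'\<close> s0(1) by auto
  have lin: "\<forall>\<^sub>F r in at_right 0. linearized T \<eta> S x r"
    by (rule eventually_linearized[OF S(1,2) \<open>0 < \<eta>\<close> M])
  have ge: "\<forall>\<^sub>F r in at_right 0. \<Delta> * c\<^sup>2 / (4 * pi) * exp ((l2 - l1) * T) * (pi * r\<^sup>2)
      \<le> measure lebesgue (ftme_ball f U T \<alpha> x r)"
    using lin by eventually_elim (rule ftme_ball_measure_ge[OF S(3,4)], use assms l1 l2 in auto)
  have le: "\<forall>\<^sub>F r in at_right 0. measure lebesgue (ftme_ball f U T \<alpha> x r)
      \<le> 4 * \<Delta> * c' / (pi * s0\<^sup>2) * exp ((l2 - l1) * T) * (pi * r\<^sup>2)"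
    using lin by eventually_elim (rule ftme_ball_measure_le, use assms in auto)
  have "l1 - l2 - ln (4 * \<Delta> * c' / (pi * s0\<^sup>2)) / T =
      - (1 / T) * (ln (4 * \<Delta> * c' / (pi * s0\<^sup>2)) + (l2 - l1) * T)"
    using \<open>0 < T\<close> by (simp add: field_simps)
  also have "ln (4 * \<Delta> * c' / (pi * s0\<^sup>2)) + (l2 - l1) * T
      = ln (4 * \<Delta> * c' / (pi * s0\<^sup>2) * exp ((l2 - l1) * T))"
    using pos by (subst ln_mult_pos) auto
  finally show ?thesis using ftme_lowerI[OF \<open>0 < T\<close> pos(1) ge le] by simp
qed

text \<open>The weak bound ignores the direction of \<open>F\<close>, since neither eigencoordinate
  shrinks faster than \<open>exp (l2 * T)\<close>. The other two depend on
  \<open>\<bar>q1 \<bullet> F\<bar> / norm F\<close>, the quantity that the cones control.\<close>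

lemma
  assumes "F \<noteq> 0" and M: "norm (M F - linear_flow T F) \<le> \<eta> * norm F" and "0 \<le> T"
  shows stretching_ge_weak: "s0 / 2 * exp (l2 * T) - \<eta> \<le> norm (M F) / norm F"
    and stretching_ge: "s0 * exp (l1 * T) * \<bar>q1 \<bullet> F\<bar> / norm F - \<eta> \<le> norm (M F) / norm F"
    and stretching_le: "norm (M F) / norm F \<le> exp (l1 * T) * \<bar>q1 \<bullet> F\<bar> / norm F + exp (l2 * T) / s0 + \<eta>"
proof -
  have F: "0 < norm F" using \<open>F \<noteq> 0\<close> by simp
  have linear_flow_ge: "s0 * (exp (l1 * T) * \<bar>q1 \<bullet> F\<bar>) \<le> norm (linear_flow T F)" "s0 * (exp (l2 * T) * \<bar>q2 \<bullet> F\<bar>) \<le> norm (linear_flow T F)"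
    using norm_ge_dual[of "linear_flow T F"] by (simp_all add: dual_linear_flow abs_mult)
  have MF: "norm (linear_flow T F) - \<eta> * norm F \<le> norm (M F)" "norm (M F) \<le> norm (linear_flow T F) + \<eta> * norm F"
    using M norm_triangle_ineq3[of "M F" "linear_flow T F"] by linarith+
  have "s0 * (exp (l2 * T) * \<bar>q1 \<bullet> F\<bar>) \<le> s0 * (exp (l1 * T) * \<bar>q1 \<bullet> F\<bar>)"
    using s0 l1 l2 \<open>0 \<le> T\<close> by (intro mult_left_mono mult_right_mono) (auto intro: mult_right_mono)
  then have "s0 * exp (l2 * T) * (\<bar>q1 \<bullet> F\<bar> + \<bar>q2 \<bullet> F\<bar>) \<le> 2 * norm (linear_flow T F)"
    using linear_flow_ge by (simp add: algebra_simps)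
  moreover have "s0 * exp (l2 * T) * norm F \<le> s0 * exp (l2 * T) * (\<bar>q1 \<bullet> F\<bar> + \<bar>q2 \<bullet> F\<bar>)"
    using s0 by (intro mult_left_mono norm_le_dual_sum) auto
  ultimately have "(s0 / 2 * exp (l2 * T) - \<eta>) * norm F \<le> norm (M F)"
    using MF by (simp add: algebra_simps)
  then show "s0 / 2 * exp (l2 * T) - \<eta> \<le> norm (M F) / norm F"
    using F by (simp add: le_divide_eq)
  have "s0 * exp (l1 * T) * \<bar>q1 \<bullet> F\<bar> - \<eta> * norm F \<le> norm (M F)"
    using linear_flow_ge(1) MF(1) by (simp only: mult.assoc)
  from divide_right_mono[OF this, of "norm F"] F
  show "s0 * exp (l1 * T) * \<bar>q1 \<bullet> F\<bar> / norm F - \<eta> \<le> norm (M F) / norm F"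
    by (simp add: diff_divide_distrib)
  have "exp (l2 * T) * \<bar>q2 \<bullet> F\<bar> \<le> exp (l2 * T) * (norm F / s0)"
    by (intro mult_left_mono dual_le_norm) auto
  then have "norm (M F) \<le> exp (l1 * T) * \<bar>q1 \<bullet> F\<bar> + exp (l2 * T) * (norm F / s0) + \<eta> * norm F"
    using norm_linear_flow_le[of T F] MF(2) by linarith
  from divide_right_mono[OF this, of "norm F"] F
  show "norm (M F) / norm F \<le> exp (l1 * T) * \<bar>q1 \<bullet> F\<bar> / norm F + exp (l2 * T) / s0 + \<eta>"
    by (simp add: add_divide_distrib)
qed

text \<open>Both eigenvalues have modulus at least \<open>m\<close>, and the nonlinear error takes
  at most \<open>m / 8\<close> from each coordinate. The field therefore has size comparable to the
  distance from \<open>xs\<close>, so position cones carry over to the direction of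
  \<open>f x\<close>.\<close>

lemma norm_f_bounds:
  assumes x: "x \<in> cball xs \<rho>" "norm (x - xs) \<le> r" "C * r / s0 \<le> m / 8"
  shows "s0 * m / 4 * norm (x - xs) \<le> norm (f x)" "norm (f x) \<le> L * norm (x - xs)"
proof -
  let ?w = "x - xs"
  have "C * r / s0 * norm ?w \<le> m / 8 * norm ?w" using x by (intro mult_right_mono) auto
  then have q: "\<bar>q1 \<bullet> f x - l1 * (q1 \<bullet> ?w)\<bar> \<le> m / 8 * norm ?w" "\<bar>q2 \<bullet> f x - l2 * (q2 \<bullet> ?w)\<bar> \<le> m / 8 * norm ?w"
    using dual_f_estimate[OF x(1,2)] by linarith+
  have "m * \<bar>q1 \<bullet> ?w\<bar> \<le> \<bar>l1 * (q1 \<bullet> ?w)\<bar>" "m * \<bar>q2 \<bullet> ?w\<bar> \<le> \<bar>l2 * (q2 \<bullet> ?w)\<bar>"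
    using m l1 l2 mult_right_mono[of m "- l2" "\<bar>q2 \<bullet> ?w\<bar>"] by (auto simp: abs_mult intro: mult_right_mono)
  moreover have "m * norm ?w \<le> m * \<bar>q1 \<bullet> ?w\<bar> + m * \<bar>q2 \<bullet> ?w\<bar>"
    using mult_left_mono[OF norm_le_dual_sum[of ?w], of m] m by (simp add: distrib_left)
  moreover have "m / 8 * norm ?w = m * norm ?w / 8" "m / 2 * norm ?w = m * norm ?w / 2" "0 \<le> m * norm ?w"
    using m by auto
  ultimately have "m / 2 * norm ?w \<le> \<bar>q1 \<bullet> f x\<bar> + \<bar>q2 \<bullet> f x\<bar>" using q by linarith
  then have "s0 * (m / 2 * norm ?w) \<le> s0 * (\<bar>q1 \<bullet> f x\<bar> + \<bar>q2 \<bullet> f x\<bar>)" using s0 by (intro mult_left_mono) auto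
  then show "s0 * m / 4 * norm ?w \<le> norm (f x)"
    using norm_ge_dual[of "f x"] by (simp add: distrib_left)
  show "norm (f x) \<le> L * norm ?w" using f_lip[of x xs] x \<rho> eq0 by simp
qed

text \<open>If \<open>a\<close> is the stretching factor along the vector field over time \<open>T\<close>, then \<open>a \<ge> c1 exp (l2 T)\<close>
  everywhere near the equilibrium, \<open>a \<ge> c1 exp ((l1 - \<epsilon> / 4) T)\<close> on the unstable cone, and
  \<open>a \<le> c3 exp (l2 T)\<close> on the stable cone.\<close>

definition c1 :: real where "c1 = min (s0 / 4) (l1 / (2 * (L + 1)))"

definition c3 :: real where "c3 = (l1\<^sup>2 / s0 + 1) / (s0 * m / 4) + 1 / s0 + 4"

lemma c1: "0 < c1" "c1 \<le> 1" "c1 \<le> s0 / 4" "c1 \<le> l1 / (2 * (L + 1))"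
proof -
  show "0 < c1" using s0(1) l1 L by (simp add: c1_def)
  show *: "c1 \<le> s0 / 4" "c1 \<le> l1 / (2 * (L + 1))"
    unfolding c1_def by (rule min.cobounded1 min.cobounded2)+
  show "c1 \<le> 1" using *(1) s0(2) by linarith
qed

lemma c3: "0 < c3"
proof -
  have "0 < l1\<^sup>2 / s0 + 1" using s0 by (simp add: add_nonneg_pos)
  then show ?thesis using s0 m by (simp add: c3_def add_pos_pos)
qed

text \<open>With \<open>\<eta>\<close> a fraction of the weakest stretching, linearization errors
  are harmless in every case. The extra conditions on \<open>r\<close> keep the nonlinear part of
  \<open>q1 \<bullet> f x\<close> below the threshold of the respective cone.\<close>

lemma weighted_ftme_near_saddle:
  assumes S: "open S" "x \<in> S" "S \<subseteq> X0 f U T" "continuous_on S (flow f U T)"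
    and M: "(flow f U T has_derivative M) (at x)" "\<And>h. norm (M h - linear_flow T h) \<le> \<eta> * norm h"
    and \<eta>: "\<eta> = c1 / 4 * exp (l2 * T)" and "0 < T"
    and x: "x \<noteq> xs" "x \<in> cball xs \<rho>" "norm (x - xs) \<le> r" "C * r / s0 \<le> m / 8"
    and \<epsilon>: "0 < \<epsilon>" "\<epsilon> < min l1 (- l2)"
  shows "f x \<noteq> 0"
    and "0 \<le> weighted_ftme f U T x"
    and "weighted_ftme f U T x \<le> ereal (l1 - l2 - ln (\<Delta> * c1\<^sup>2 / (4 * pi)) / T)"
    and "2 * exp (- (\<epsilon> / 4) * T) * norm (x - xs) \<le> s0 * \<bar>q1 \<bullet> (x - xs)\<bar> \<Longrightarrow>
      C * r / s0 \<le> l1 * exp (- (\<epsilon> / 4) * T) / s0 \<Longrightarrow>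
      weighted_ftme f U T x \<le> ereal (\<epsilon> / 4 - ln (\<Delta> * c1\<^sup>2 / (4 * pi)) / T)"
    and "s0 * \<bar>q1 \<bullet> (x - xs)\<bar> \<le> \<epsilon> / 4 * exp ((l2 - l1) * T) * norm (x - xs) \<Longrightarrow>
      C * r / s0 \<le> exp ((l2 - l1) * T) \<Longrightarrow>
      ereal (l1 - l2 - ln (4 * \<Delta> * c3 / (pi * s0\<^sup>2)) / T) \<le> weighted_ftme f U T x"
proof -
  let ?w = "x - xs" and ?F = "f x"
  have w: "0 < norm ?w" using x by simp
  note F_bnd = norm_f_bounds[OF x(2-4)]
  have "0 < s0 * m / 4 * norm ?w" using w s0 m by simp
  then have F: "0 < norm ?F" using F_bnd(1) by linarith
  then show "f x \<noteq> 0" by simp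
  note q1F = dual_f_estimate(1)[OF x(2,3)]
  have "0 < \<eta>" using c1 by (simp add: \<eta>)
  define \<alpha> where "\<alpha> = stretching_rate f U x T ?F"
  have H: "weighted_ftme f U T x = ftme f U T \<alpha> x" by (simp add: weighted_ftme_def \<alpha>_def)
  have weak: "s0 / 2 * exp (l2 * T) - \<eta> \<le> norm (M ?F) / norm ?F"
    by (rule stretching_ge_weak[where M = M]) (use \<open>f x \<noteq> 0\<close> M(2) \<open>0 < T\<close> in auto)
  \<comment> \<open>By the term \<open>s0 / 4\<close> in \<open>c1\<close>, the weak bound gives
    twice \<open>c1 * exp (l2 * T)\<close>; the surplus pays for \<open>\<eta>\<close>.\<close>
  have "2 * c1 * exp (l2 * T) \<le> s0 / 2 * exp (l2 * T)" using c1(3) by (intro mult_right_mono) auto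
  then have "2 * c1 * exp (l2 * T) - \<eta> \<le> norm (M ?F) / norm ?F" using weak by linarith
  moreover have "\<eta> \<le> c1 * exp (l2 * T)" "0 < c1 * exp (l2 * T)" using c1 by (auto simp: \<eta>)
  ultimately have A1: "c1 * exp (l2 * T) \<le> norm (M ?F) / norm ?F"
    and "0 < norm (M ?F) / norm ?F" by linarith+
  then have "M ?F \<noteq> 0" by auto
  then have A: "exp (\<alpha> * T) = norm (M ?F) / norm ?F"
    unfolding \<alpha>_def using exp_stretching_rate[OF \<open>0 < T\<close> M(1) \<open>f x \<noteq> 0\<close>] by simp
  show "0 \<le> weighted_ftme f U T x" using ftme_nonneg[OF \<open>0 < T\<close>] by (simp add: H)
  show "weighted_ftme f U T x \<le> ereal (l1 - l2 - ln (\<Delta> * c1\<^sup>2 / (4 * pi)) / T)"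
    unfolding H
    by (rule ftme_le_of_stretching[OF S M \<open>0 < T\<close> \<open>0 < \<eta>\<close> c1(1,2)]) (use A A1 l1 l2 in \<open>auto simp: \<eta>\<close>)
  show "weighted_ftme f U T x \<le> ereal (\<epsilon> / 4 - ln (\<Delta> * c1\<^sup>2 / (4 * pi)) / T)"
    if cone: "2 * exp (- (\<epsilon> / 4) * T) * norm ?w \<le> s0 * \<bar>q1 \<bullet> ?w\<bar>"
      and r: "C * r / s0 \<le> l1 * exp (- (\<epsilon> / 4) * T) / s0"
  proof -
    define g where "g = exp (- (\<epsilon> / 4) * T)"
    have "0 < g" by (simp add: g_def)
    define \<gamma> where "\<gamma> = l1 - \<epsilon> / 4"
    have \<gamma>: "l2 \<le> \<gamma>" "\<gamma> \<le> l1" using \<epsilon> l1 l2 by (auto simp: \<gamma>_def)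
    have eg: "exp (l1 * T) * g = exp (\<gamma> * T)" by (simp add: g_def \<gamma>_def exp_add[symmetric] algebra_simps)
    have "C * r / s0 * norm ?w \<le> l1 * g / s0 * norm ?w" using r by (intro mult_right_mono) (auto simp: g_def)
    \<comment> \<open>The factor 2 in the cone is spent here: half of the linear part of
      \<open>q1 \<bullet> f x\<close> covers the nonlinear error, the other half survives.\<close>
    moreover have "l1 * (2 * g * norm ?w) \<le> l1 * (s0 * \<bar>q1 \<bullet> ?w\<bar>)"
      using cone l1 by (intro mult_left_mono) (auto simp: g_def)
    then have "2 * (l1 * g / s0 * norm ?w) \<le> l1 * \<bar>q1 \<bullet> ?w\<bar>" using s0 by (simp add: field_simps)
    moreover have "\<bar>l1 * (q1 \<bullet> ?w)\<bar> = l1 * \<bar>q1 \<bullet> ?w\<bar>" using l1 by (simp add: abs_mult)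
    ultimately have "l1 * g / s0 * norm ?w \<le> \<bar>q1 \<bullet> ?F\<bar>" using q1F by linarith
    then have "l1 * g * norm ?w \<le> s0 * \<bar>q1 \<bullet> ?F\<bar>" using s0 by (simp add: field_simps)
    moreover have "norm ?F \<le> (L + 1) * norm ?w" using F_bnd(2) w unfolding distrib_right by linarith
    then have "l1 * g * norm ?F \<le> l1 * g * ((L + 1) * norm ?w)"
      using l1 \<open>0 < g\<close> by (intro mult_left_mono) auto
    ultimately have "l1 / (L + 1) * g * norm ?F \<le> s0 * \<bar>q1 \<bullet> ?F\<bar>"
      using L by (simp add: field_simps) (smt (verit) mult_left_mono)
    then have "exp (l1 * T) * (l1 / (L + 1) * g * norm ?F) \<le> exp (l1 * T) * (s0 * \<bar>q1 \<bullet> ?F\<bar>)"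
      by (intro mult_left_mono) auto
    then have "l1 / (L + 1) * exp (\<gamma> * T) \<le> s0 * exp (l1 * T) * \<bar>q1 \<bullet> ?F\<bar> / norm ?F"
      using F unfolding eg[symmetric] by (simp add: le_divide_eq mult_ac)
    also have "\<dots> - \<eta> \<le> norm (M ?F) / norm ?F"
      by (rule stretching_ge[where M = M]) (use \<open>f x \<noteq> 0\<close> M(2) \<open>0 < T\<close> in auto)
    finally have "l1 / (L + 1) * exp (\<gamma> * T) - \<eta> \<le> norm (M ?F) / norm ?F" by simp
    moreover have "2 * c1 * exp (\<gamma> * T) \<le> l1 / (L + 1) * exp (\<gamma> * T)"
    proof (intro mult_right_mono)
      have "2 * c1 \<le> 2 * (l1 / (2 * (L + 1)))" using c1(4) by (intro mult_left_mono) auto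
      also have "\<dots> = l1 / (L + 1)" using L by (simp add: field_simps)
      finally show "2 * c1 \<le> l1 / (L + 1)" .
    qed simp
    moreover have 4: "4 * \<eta> \<le> c1 * exp (\<gamma> * T)"
      unfolding \<eta> using \<gamma> c1 \<open>0 < T\<close> by (simp add: mult_right_mono)
    ultimately have "c1 * exp (\<gamma> * T) \<le> exp (\<alpha> * T)" using A \<open>0 < \<eta>\<close> by linarith
    from ftme_le_of_stretching[OF S M \<open>0 < T\<close> \<open>0 < \<eta>\<close> c1(1,2) \<gamma> this 4]
    show ?thesis by (simp add: H \<gamma>_def)
  qed
  show "ereal (l1 - l2 - ln (4 * \<Delta> * c3 / (pi * s0\<^sup>2)) / T) \<le> weighted_ftme f U T x"
    if cone: "s0 * \<bar>q1 \<bullet> ?w\<bar> \<le> \<epsilon> / 4 * exp ((l2 - l1) * T) * norm ?w"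
      and r: "C * r / s0 \<le> exp ((l2 - l1) * T)"
  proof -
    define g where "g = exp ((l2 - l1) * T)"
    have "0 < g" by (simp add: g_def)
    have eg: "exp (l1 * T) * g = exp (l2 * T)" by (simp add: g_def exp_add[symmetric] algebra_simps)
    have "s0 * \<bar>q1 \<bullet> ?w\<bar> \<le> l1 * g * norm ?w"
    proof -
      \<comment> \<open>Replacing \<open>\<epsilon> / 4\<close> by \<open>l1\<close> keeps
        \<open>c3\<close> independent of \<open>\<epsilon>\<close>.\<close>
      have "\<epsilon> / 4 * g * norm ?w \<le> l1 * g * norm ?w"
        using \<epsilon> \<open>0 < g\<close> by (intro mult_right_mono) auto
      then show ?thesis using cone unfolding g_def by linarith
    qed
    then have "l1 * \<bar>q1 \<bullet> ?w\<bar> \<le> l1\<^sup>2 / s0 * g * norm ?w"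
      using s0 l1 by (simp add: power2_eq_square field_simps)
    moreover have "\<bar>l1 * (q1 \<bullet> ?w)\<bar> = l1 * \<bar>q1 \<bullet> ?w\<bar>" using l1 by (simp add: abs_mult)
    moreover have "C * r / s0 * norm ?w \<le> g * norm ?w" using r by (intro mult_right_mono) (auto simp: g_def)
    ultimately have "\<bar>q1 \<bullet> ?F\<bar> \<le> l1\<^sup>2 / s0 * g * norm ?w + g * norm ?w" using q1F by linarith
    also have "\<dots> = (l1\<^sup>2 / s0 + 1) * g * norm ?w" by (simp add: algebra_simps)
    also have "\<dots> \<le> (l1\<^sup>2 / s0 + 1) * g * (norm ?F / (s0 * m / 4))"
      using F_bnd(1) s0 m \<open>0 < g\<close> by (intro mult_left_mono) (auto simp: field_simps)
    finally have "\<bar>q1 \<bullet> ?F\<bar> / norm ?F \<le> (l1\<^sup>2 / s0 + 1) / (s0 * m / 4) * g"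
      using F by (simp add: divide_le_eq mult_ac)
    then have "exp (l1 * T) * (\<bar>q1 \<bullet> ?F\<bar> / norm ?F) \<le> exp (l1 * T) * ((l1\<^sup>2 / s0 + 1) / (s0 * m / 4) * g)"
      by (intro mult_left_mono) auto
    also have "\<dots> = (l1\<^sup>2 / s0 + 1) / (s0 * m / 4) * exp (l2 * T)" unfolding eg[symmetric] by simp
    finally have "exp (l1 * T) * \<bar>q1 \<bullet> ?F\<bar> / norm ?F \<le> (l1\<^sup>2 / s0 + 1) / (s0 * m / 4) * exp (l2 * T)" by simp
    moreover have "norm (M ?F) / norm ?F \<le> exp (l1 * T) * \<bar>q1 \<bullet> ?F\<bar> / norm ?F + exp (l2 * T) / s0 + \<eta>"
      by (rule stretching_le) (use \<open>f x \<noteq> 0\<close> M(2) \<open>0 < T\<close> in auto)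
    moreover have "c1 * exp (l2 * T) \<le> 1 * exp (l2 * T)" using c1 by (intro mult_right_mono) auto
    then have "3 * \<eta> \<le> 4 * exp (l2 * T)" by (simp add: \<eta>)
    \<comment> \<open>The three summands of \<open>c3\<close> account for the expanding component of
      \<open>f x\<close>, its contracting component, and the error
      \<open>3 * \<eta>\<close>.\<close>
    moreover have "c3 * exp (l2 * T) =
        (l1\<^sup>2 / s0 + 1) / (s0 * m / 4) * exp (l2 * T) + exp (l2 * T) / s0 + 4 * exp (l2 * T)"
      by (simp add: c3_def distrib_right)
    ultimately have "exp (\<alpha> * T) + 2 * \<eta> \<le> c3 * exp (l2 * T)" unfolding A by linarith
    from ftme_ge_of_stretching[OF S M \<open>0 < T\<close> \<open>0 < \<eta>\<close> c1(1,2) _ _ c3 this] A A1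
    show ?thesis by (simp add: H \<eta>)
  qed
qed

lemma saddle_properties:
  assumes \<epsilon>: "0 < \<epsilon>" "\<epsilon> < min l1 (- l2)" and "0 < T"
    and T: "2 * exp (- (\<epsilon> / 4) * T) \<le> s0 / 2"
      "- ln (\<Delta> * c1\<^sup>2 / (4 * pi)) / T < \<epsilon> / 2" "ln (4 * \<Delta> * c3 / (pi * s0\<^sup>2)) / T < \<epsilon>"
    and r0: "0 < r0" "r0 \<le> \<rho>" "4 * (C * r0 / s0) \<le> m"
  obtains \<delta> where "0 < \<delta>" and "\<And>x. x \<in> cball xs \<delta> - {xs} \<Longrightarrow>
      x \<in> weighted_ftme_domain f U T \<and>
      0 \<le> weighted_ftme f U T x \<and> weighted_ftme f U T x < ereal (l1 - l2 + \<epsilon>) \<and>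
      (x \<in> unstable_manifold f (ball xs r0) xs \<longrightarrow> x \<in> unstable_cone \<epsilon> T xs e2) \<and>
      (x \<in> unstable_cone \<epsilon> T xs e2 \<longrightarrow> weighted_ftme f U T x < ereal \<epsilon>) \<and>
      (x \<in> stable_manifold f (ball xs r0) xs \<longrightarrow> x \<in> stable_cone l1 l2 \<epsilon> T xs e2) \<and>
      (x \<in> stable_cone l1 l2 \<epsilon> T xs e2 \<longrightarrow> ereal (l1 - l2 - \<epsilon>) < weighted_ftme f U T x)"
proof -
  define \<eta> where "\<eta> = c1 / 4 * exp (l2 * T)"
  have "0 < \<eta>" using c1 by (simp add: \<eta>_def)
  obtain \<delta>' where \<delta>': "0 < \<delta>'" "\<delta>' \<le> \<rho>"
    and flow: "\<And>x. x \<in> ball xs \<delta>' \<Longrightarrow> x \<in> X0 f U T \<and> (\<exists>M. (flow f U T has_derivative M) (at x) \<and>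
       (\<forall>h. norm (M h - linear_flow T h) \<le> \<eta> * norm h))"
    using flow_derivative_near_linear[OF less_imp_le[OF \<open>0 < T\<close>] \<open>0 < \<eta>\<close>] by blast
  define S where "S = ball xs \<delta>'"
  have S: "open S" "S \<subseteq> X0 f U T" using flow by (auto simp: S_def)
  have contS: "continuous_on S (flow f U T)"
    by (rule continuous_at_imp_continuous_on) (use flow has_derivative_continuous S_def in blast)
  \<comment> \<open>The opening that corresponds to the stable cone, capped at 1 as the cone
    estimate requires.\<close>
  define k where "k = min 1 (\<epsilon> / 4 * exp ((l2 - l1) * T))"
  have k: "0 < k" "k \<le> 1" "k \<le> \<epsilon> / 4 * exp ((l2 - l1) * T)" using \<epsilon> by (auto simp: k_def)
  define \<mu> where "\<mu> = min (m * k) (min (l1 * exp (- (\<epsilon> / 4) * T)) (exp ((l2 - l1) * T)))"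
  have \<mu>: "0 < \<mu>" "\<mu> \<le> m * k" "\<mu> \<le> l1 * exp (- (\<epsilon> / 4) * T)" "\<mu> \<le> exp ((l2 - l1) * T)"
    using m k l1 by (auto simp: \<mu>_def)
  \<comment> \<open>The first term puts the closed ball inside \<open>S\<close>, the second keeps
    the enlarged radius \<open>2 / s0 * \<delta>\<close> below \<open>\<rho>\<close>, and the third
    gives \<open>8 * (C * \<delta> / s0 / s0) \<le> \<mu>\<close>, which covers all demands on the
    nonlinear error.\<close>
  define \<delta> where "\<delta> = min (\<delta>' / 2) (min (\<rho> * s0 / 2) (s0\<^sup>2 * \<mu> / (8 * (C + 1))))"
  have \<delta>: "0 < \<delta>" using \<delta>' \<rho>(1) s0(1) \<mu>(1) C by (simp add: \<delta>_def)
  have "\<delta> \<le> \<delta>' / 2" "\<delta> \<le> \<rho> * s0 / 2" by (simp_all only: \<delta>_def min.cobounded1 min.coboundedI2)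
  with \<delta> \<delta>' have \<delta>: "0 < \<delta>" "\<delta> < \<delta>'" "\<delta> \<le> \<rho> * s0 / 2" by auto
  have "8 * (C * \<delta>) \<le> 8 * (C + 1) * \<delta>" using \<delta> by (simp add: algebra_simps)
  also have "\<dots> \<le> 8 * (C + 1) * (s0\<^sup>2 * \<mu> / (8 * (C + 1)))"
    using C by (intro mult_left_mono) (auto simp: \<delta>_def)
  also have "\<dots> = s0\<^sup>2 * \<mu>" using C by simp
  finally have "8 * (C * \<delta> / s0) \<le> s0 * \<mu>" using s0 by (simp add: power2_eq_square field_simps)
  then have C\<delta>: "8 * (C * \<delta> / s0 / s0) \<le> \<mu>" using s0 by (simp add: field_simps)
  have "s0 * \<mu> \<le> 1 * \<mu>" using s0 \<mu> by (intro mult_right_mono) auto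
  with \<open>8 * (C * \<delta> / s0) \<le> s0 * \<mu>\<close> have C\<delta>': "C * \<delta> / s0 \<le> \<mu> / 8" by linarith
  have "m * k \<le> m * 1" using m k by (intro mult_left_mono) auto
  with C\<delta>' \<mu> have C\<delta>_m: "C * \<delta> / s0 \<le> m / 8" by linarith
  have "l1 * exp (- (\<epsilon> / 4) * T) * s0 \<le> l1 * exp (- (\<epsilon> / 4) * T) * 1"
    using l1 s0 by (intro mult_left_mono) auto
  then have "l1 * exp (- (\<epsilon> / 4) * T) \<le> l1 * exp (- (\<epsilon> / 4) * T) / s0" using s0 by (simp add: le_divide_eq)
  then have C\<delta>_u: "C * \<delta> / s0 \<le> l1 * exp (- (\<epsilon> / 4) * T) / s0" using C\<delta>' \<mu> by linarith
  have C\<delta>_s: "C * \<delta> / s0 \<le> exp ((l2 - l1) * T)" using C\<delta>' \<mu> by linarith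
  show ?thesis
  proof (rule that[OF \<open>0 < \<delta>\<close>])
    fix x assume "x \<in> cball xs \<delta> - {xs}"
    then have x: "x \<noteq> xs" "norm (x - xs) \<le> \<delta>" by (auto simp: dist_norm norm_minus_commute)
    then have "x \<in> S" and x_in: "x \<in> cball xs \<rho>" using \<delta> \<delta>' by (auto simp: S_def dist_norm norm_minus_commute)
    then obtain M where M: "(flow f U T has_derivative M) (at x)" "\<And>h. norm (M h - linear_flow T h) \<le> \<eta> * norm h"
      using flow S_def by blast
    note b = weighted_ftme_near_saddle[OF S(1) \<open>x \<in> S\<close> S(2) contS M \<eta>_def \<open>0 < T\<close> x(1) x_in x(2) C\<delta>_m \<epsilon>]
    let ?w = "x - xs" and ?H = "weighted_ftme f U T x"
    have w: "0 < norm ?w" using x by simp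
    have sin: "sin \<bar>vec_angle (?w /\<^sub>R norm ?w) e2\<bar> = s0 * \<bar>q1 \<bullet> ?w\<bar> / norm ?w"
      using x by (intro sin_vec_angle) simp
    have Cu: "x \<in> unstable_cone \<epsilon> T xs e2 \<longleftrightarrow> 2 * exp (- (\<epsilon> / 4) * T) * norm ?w \<le> s0 * \<bar>q1 \<bullet> ?w\<bar>"
      using x w unfolding unstable_cone_def by (simp add: sin le_divide_eq)
    have Cs: "x \<in> stable_cone l1 l2 \<epsilon> T xs e2 \<longleftrightarrow> s0 * \<bar>q1 \<bullet> ?w\<bar> \<le> \<epsilon> / 4 * exp ((l2 - l1) * T) * norm ?w"
      using x w unfolding stable_cone_def by (simp add: sin divide_le_eq)
    have "x \<in> weighted_ftme_domain f U T"
      using b(1) S(2) \<open>x \<in> S\<close> by (auto simp: weighted_ftme_domain_def)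
    moreover have "?H < ereal (l1 - l2 + \<epsilon>)"
      using b(3) by (rule le_less_trans) (simp only: less_ereal.simps, use T(2) \<epsilon> in linarith)
    moreover have "x \<in> unstable_cone \<epsilon> T xs e2" if "x \<in> unstable_manifold f (ball xs r0) xs"
    proof -
      have "norm ?w \<le> 2 * \<bar>q1 \<bullet> ?w\<bar>"
        using norm_le_dual_sum[of ?w] unstable_manifold_cone[OF that r0] by linarith
      then have "s0 / 2 * norm ?w \<le> s0 / 2 * (2 * \<bar>q1 \<bullet> ?w\<bar>)" using s0 by (intro mult_left_mono) auto
      moreover have "2 * exp (- (\<epsilon> / 4) * T) * norm ?w \<le> s0 / 2 * norm ?w"
        using T(1) by (intro mult_right_mono) auto
      ultimately show ?thesis by (simp add: Cu)
    qed
    moreover have "?H < ereal \<epsilon>" if "x \<in> unstable_cone \<epsilon> T xs e2"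
      using b(4)[OF that[unfolded Cu] C\<delta>_u] by (rule le_less_trans) (simp only: less_ereal.simps, use T(2) \<epsilon> in linarith)
    moreover have "x \<in> stable_cone l1 l2 \<epsilon> T xs e2" if "x \<in> stable_manifold f (ball xs r0) xs"
    proof -
      have "\<bar>q1 \<bullet> ?w\<bar> \<le> k * \<bar>q2 \<bullet> ?w\<bar>"
      proof (rule stable_manifold_cone[OF that r0 k(1,2) x(2) \<delta>(1)])
        show "2 / s0 * \<delta> \<le> \<rho>" using \<delta>(3) s0(1) by (simp add: field_simps)
        have "4 * (C * (2 / s0 * \<delta>) / s0) = 8 * (C * \<delta> / s0 / s0)" by simp
        then show "4 * (C * (2 / s0 * \<delta>) / s0) \<le> m * k" using C\<delta> \<mu>(2) by linarith
      qed
      then have "s0 * \<bar>q1 \<bullet> ?w\<bar> \<le> s0 * (k * \<bar>q2 \<bullet> ?w\<bar>)" using s0 by (intro mult_left_mono) auto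
      also have "\<dots> = k * (s0 * \<bar>q2 \<bullet> ?w\<bar>)" by simp
      also have "\<dots> \<le> \<epsilon> / 4 * exp ((l2 - l1) * T) * norm ?w"
        using k norm_ge_dual(2)[of ?w] \<epsilon> s0 by (intro mult_mono) auto
      finally show ?thesis by (simp add: Cs)
    qed
    moreover have "ereal (l1 - l2 - \<epsilon>) < ?H" if "x \<in> stable_cone l1 l2 \<epsilon> T xs e2"
      using b(5)[OF that[unfolded Cs] C\<delta>_s] by (rule less_le_trans[rotated]) (simp only: less_ereal.simps, use T(3) in linarith)
    ultimately show "x \<in> weighted_ftme_domain f U T \<and>
      0 \<le> ?H \<and> ?H < ereal (l1 - l2 + \<epsilon>) \<and>
      (x \<in> unstable_manifold f (ball xs r0) xs \<longrightarrow> x \<in> unstable_cone \<epsilon> T xs e2) \<and>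
      (x \<in> unstable_cone \<epsilon> T xs e2 \<longrightarrow> ?H < ereal \<epsilon>) \<and>
      (x \<in> stable_manifold f (ball xs r0) xs \<longrightarrow> x \<in> stable_cone l1 l2 \<epsilon> T xs e2) \<and>
      (x \<in> stable_cone l1 l2 \<epsilon> T xs e2 \<longrightarrow> ereal (l1 - l2 - \<epsilon>) < ?H)"
      using b(2) by blast
  qed
qed

text \<open>The conditions involve \<open>\<epsilon>\<close> and constants of the saddle but no
  radius, so the time threshold can be fixed before \<open>\<delta>\<close>.\<close>

lemma eventually_large_time:
  assumes "0 < \<epsilon>"
  obtains T0 where "0 < T0" and "\<And>T. T0 \<le> T \<Longrightarrow> 2 * exp (- (\<epsilon> / 4) * T) \<le> s0 / 2 \<and>
      - ln (\<Delta> * c1\<^sup>2 / (4 * pi)) / T < \<epsilon> / 2 \<and> ln (4 * \<Delta> * c3 / (pi * s0\<^sup>2)) / T < \<epsilon>"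
proof -
  have lim: "((\<lambda>T. a / T) \<longlongrightarrow> 0) at_top" for a :: real
    by (intro tendsto_divide_0[OF tendsto_const] filterlim_at_top_imp_at_infinity filterlim_ident)
  have "((\<lambda>T. exp (- (\<epsilon> / 4) * T)) \<longlongrightarrow> 0) at_top"
    using assms by (intro filterlim_compose[OF exp_at_bot] filterlim_tendsto_neg_mult_at_bot[OF tendsto_const _ filterlim_ident]) auto
  then have "\<forall>\<^sub>F T in at_top. exp (- (\<epsilon> / 4) * T) < s0 / 4"
    using s0 by (intro order_tendstoD) auto
  moreover have "\<forall>\<^sub>F T in at_top. - ln (\<Delta> * c1\<^sup>2 / (4 * pi)) / T < \<epsilon> / 2"
    using assms by (intro order_tendstoD(2)[OF lim]) auto
  moreover have "\<forall>\<^sub>F T in at_top. ln (4 * \<Delta> * c3 / (pi * s0\<^sup>2)) / T < \<epsilon>"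
    using assms by (intro order_tendstoD(2)[OF lim]) auto
  ultimately have "\<forall>\<^sub>F T in at_top. 2 * exp (- (\<epsilon> / 4) * T) \<le> s0 / 2 \<and>
      - ln (\<Delta> * c1\<^sup>2 / (4 * pi)) / T < \<epsilon> / 2 \<and> ln (4 * \<Delta> * c3 / (pi * s0\<^sup>2)) / T < \<epsilon>"
    by eventually_elim auto
  then obtain N where "\<And>T. N \<le> T \<Longrightarrow> 2 * exp (- (\<epsilon> / 4) * T) \<le> s0 / 2 \<and>
      - ln (\<Delta> * c1\<^sup>2 / (4 * pi)) / T < \<epsilon> / 2 \<and> ln (4 * \<Delta> * c3 / (pi * s0\<^sup>2)) / T < \<epsilon>"
    by (auto simp: eventually_at_top_linorder)
  then show ?thesis using that[of "max N 1"] by auto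
qed

end

section \<open>Assembling the result\<close>

lemma C2_saddle_at_equilibrium:
  fixes f :: "real^2 \<Rightarrow> real^2"
  assumes "open U" "C2_on f U" "xs \<in> U" "f xs = 0" "l1 > 0" "0 > l2"
    and e1: "eigenpair (jacobian f (at xs)) l1 e1" "norm e1 = 1"
    and e2: "eigenpair (jacobian f (at xs)) l2 e2" "norm e2 = 1"
  obtains D \<rho> C L where "C2_saddle f U xs D \<rho> C L e1 e2 l1 l2"
proof -
  obtain D :: "real^2 \<Rightarrow> (real^2) \<Rightarrow>\<^sub>L (real^2)"
    where D: "\<And>x. x \<in> U \<Longrightarrow> (f has_derivative D x) (at x)"
      and *: "\<And>p. p \<in> U \<Longrightarrow> \<exists>r>0. \<exists>C\<ge>0. \<exists>L\<ge>0. cball p r \<subseteq> U \<and> (\<forall>x\<in>cball p r. norm (D x) \<le> L) \<and>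
       (\<forall>x\<in>cball p r. \<forall>y\<in>cball p r. norm (D x - D y) \<le> C * norm (x - y))"
    using C2_on_local_bounds[OF assms(1,2)] by blast
  from *[OF \<open>xs \<in> U\<close>] obtain \<rho> C L where \<rho>: "0 < \<rho>" "0 \<le> C" "0 \<le> L" "cball xs \<rho> \<subseteq> U"
    "\<And>x. x \<in> cball xs \<rho> \<Longrightarrow> norm (D x) \<le> L"
    "\<And>x y. x \<in> cball xs \<rho> \<Longrightarrow> y \<in> cball xs \<rho> \<Longrightarrow> norm (D x - D y) \<le> C * norm (x - y)" by blast
  have "jacobian f (at xs) *v z = D xs z" for z
    using frechet_derivative_at[OF D[OF \<open>xs \<in> U\<close>]] blinfun.bounded_linear_right[of "D xs"]
    by (simp add: jacobian_def matrix_works bounded_linear.linear)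
  then have "D xs e1 = l1 *\<^sub>R e1" "D xs e2 = l2 *\<^sub>R e2"
    using e1 e2 by (auto simp: eigenpair_def scalar_mult_eq_scaleR)
  then have "C2_saddle f U xs D \<rho> C L e1 e2 l1 l2"
    using assms \<rho> D C2_on_local_lipschitz[OF assms(1,2)] by unfold_locales auto
  then show ?thesis by (rule that)
qed

theorem theorem20:
  fixes f :: "real^2 \<Rightarrow> real^2" and U :: "(real^2) set"
    and xs e1 e2 :: "real^2" and l1 l2 :: real
  assumes "open U" and "C2_on f U"
    and "isolated_equilibrium f U xs" and "hyperbolic_at f xs"
    and "l1 > 0" and "0 > l2"
    and "eigenpair (jacobian f (at xs)) l1 e1" and "norm e1 = 1"
    and "eigenpair (jacobian f (at xs)) l2 e2" and "norm e2 = 1"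
  shows "\<exists>V. open V \<and> xs \<in> V \<and> V \<subseteq> U \<and>
    (\<forall>\<epsilon>. 0 < \<epsilon> \<and> \<epsilon> < min l1 (- l2) \<longrightarrow>
      (\<exists>T\<^sub>0>0. \<forall>T\<ge>T\<^sub>0. \<exists>\<delta>>0.
        let B = cball xs \<delta> - {xs};
            H = weighted_ftme f U T;
            Cu = unstable_cone \<epsilon> T xs e2;
            Cs = stable_cone l1 l2 \<epsilon> T xs e2;
            Wu = unstable_manifold f V xs;
            Ws = stable_manifold f V xs
        in B \<subseteq> weighted_ftme_domain f U T \<and>
           (\<forall>x\<in>B. 0 \<le> H x \<and> H x < ereal (l1 - l2 + \<epsilon>)) \<and>
           Wu \<inter> B \<subseteq> Cu \<and>
           (\<forall>x\<in>Cu \<inter> B. 0 \<le> H x \<and> H x < ereal \<epsilon>) \<and>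
           Ws \<inter> B \<subseteq> Cs \<and>
           (\<forall>x\<in>Cs \<inter> B. H x > ereal (l1 - \<epsilon>)) \<and>
           (\<forall>x\<in>Ws \<inter> B. ereal (l1 - l2 - \<epsilon>) < H x \<and> H x < ereal (l1 - l2 + \<epsilon>))))"
proof -
  have "xs \<in> U" "f xs = 0"
    using assms(3) by (auto simp: isolated_equilibrium_def isolated_in_def)
  then obtain D \<rho> C L where "C2_saddle f U xs D \<rho> C L e1 e2 l1 l2"
    using C2_saddle_at_equilibrium[OF assms(1,2) _ _ assms(5-10)] by blast
  then interpret C2_saddle f U xs D \<rho> C L e1 e2 l1 l2 .
  \<comment> \<open>The radius of \<open>V\<close> depends only on the saddle, not on
    \<open>\<epsilon>\<close> or \<open>T\<close>; it is small enough for the cones of opening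
    1.\<close>
  define r0 where "r0 = min \<rho> (m * s0 / (4 * (C + 1)))"
  have r0: "0 < r0" "r0 \<le> \<rho>" using \<rho> m(1) s0(1) C by (auto simp: r0_def)
  have "4 * (C * r0) \<le> 4 * (C + 1) * r0" using r0 by (simp add: algebra_simps)
  also have "\<dots> \<le> 4 * (C + 1) * (m * s0 / (4 * (C + 1)))"
    using C by (intro mult_left_mono) (auto simp: r0_def)
  also have "\<dots> = m * s0" using C by simp
  finally have C_r0: "4 * (C * r0 / s0) \<le> m" using s0(1) by (simp add: field_simps)
  show ?thesis
  proof (intro exI[of _ "ball xs r0"] conjI allI impI, goal_cases)
    case 3
    show ?case using r0(2) \<rho>(2) by auto
  next
    case (4 \<epsilon>)
    then obtain T0 where "0 < T0" and T0: "\<And>T. T0 \<le> T \<Longrightarrow> 2 * exp (- (\<epsilon> / 4) * T) \<le> s0 / 2 \<and>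
        - ln (\<Delta> * c1\<^sup>2 / (4 * pi)) / T < \<epsilon> / 2 \<and> ln (4 * \<Delta> * c3 / (pi * s0\<^sup>2)) / T < \<epsilon>"
      using eventually_large_time by blast
    show ?case
    proof (rule exI[of _ T0], intro conjI allI impI, goal_cases)
      case (2 T)
      then have "0 < T" using \<open>0 < T0\<close> by simp
      obtain \<delta> where "0 < \<delta>" and \<delta>: "\<And>x. x \<in> cball xs \<delta> - {xs} \<Longrightarrow>
          x \<in> weighted_ftme_domain f U T \<and>
          0 \<le> weighted_ftme f U T x \<and> weighted_ftme f U T x < ereal (l1 - l2 + \<epsilon>) \<and>
          (x \<in> unstable_manifold f (ball xs r0) xs \<longrightarrow> x \<in> unstable_cone \<epsilon> T xs e2) \<and>
          (x \<in> unstable_cone \<epsilon> T xs e2 \<longrightarrow> weighted_ftme f U T x < ereal \<epsilon>) \<and>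
          (x \<in> stable_manifold f (ball xs r0) xs \<longrightarrow> x \<in> stable_cone l1 l2 \<epsilon> T xs e2) \<and>
          (x \<in> stable_cone l1 l2 \<epsilon> T xs e2 \<longrightarrow> ereal (l1 - l2 - \<epsilon>) < weighted_ftme f U T x)"
        using saddle_properties[of \<epsilon> T r0] 4 T0[OF 2] \<open>0 < T\<close> r0 C_r0 by blast
      \<comment> \<open>As \<open>l2 < 0\<close>, the bound proved on the whole stable cone is
        stronger than \<open>l1 - \<epsilon>\<close>; it serves both the cone and the stable
        manifold inside it.\<close>
      have "ereal (l1 - \<epsilon>) < h" if "ereal (l1 - l2 - \<epsilon>) < h" for h
        using that by (rule less_trans[rotated]) (use l2 in simp)
      then show ?case
        unfolding Let_def using \<delta> \<open>0 < \<delta>\<close>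
        by (intro exI[of _ \<delta>] conjI ballI subsetI; (elim IntE)?)
           (simp_all del: mem_cball less_ereal.simps ereal_less)
    qed (use \<open>0 < T0\<close> in simp)
  qed (use r0 in auto)
qed

end
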